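(* Let $n\ge 1$ and $s\ge 1$ be integers, and let $\mathcal{R}(J(P_n)^s)=Y_1,\dots,Y_p$ be the rooted list of minimal generators of $J(P_n)^s$. Then $J(P_n)^s$ has linear quotients with respect to the order $Y_1,\dots,Y_p$; that is, for every $r=2,\dots,p$ the colon ideal $(Y_1,\dots,Y_{r-1}):(Y_r)$ is generated by some of the variables $x_1,\dots,x_n$.
   Context: Let $S=\Bbbk[x_1,\dots,x_n]$ be a polynomial ring over a field $\Bbbk$. For a monomial ideal $I$, $G(I)$ denotes its set of minimal monomial generators. $P_n$ is the path graph with vertices $x_1,\dots,x_n$ and edges $\{x_i,x_{i+1}\}$, $1\le i\le n-1$. The cover ideal of a finite simple graph $G$ is $J(G)=\bigcap_{\{x_i,x_j\}\in E(G)}(x_i,x_j)$ (equal to $(1)$ if $G$ has no edges); its minimal generators are the products of the variables in the minimal vertex covers of $G$. The rooted list $\mathcal{R}(P_n)$ is the list of monomials defined recursively by $\mathcal{R}(P_1)=1$; $\mathcal{R}(P_2)=x_1,x_2$; $\mathcal{R}(P_3)=x_2,\,x_1x_3$; and for $n\ge 4$, if $\mathcal{R}(P_{n-2})=u_1,\dots,u_r$ and $\mathcal{R}(P_{n-3})=v_1,\dots,v_t$, then $\mathcal{R}(P_n)=x_{n-1}u_1,\dots,x_{n-1}u_r,\,x_nx_{n-2}v_1,\dots,x_nx_{n-2}v_t$. It is known that $\mathcal{R}(P_n)$ lists the elements of $G(J(P_n))$ without repetition. Let $\mathcal{R}(P_n)=u_1,\dots,u_q$. An $s$-fold product is a monomial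 $u_1^{a_1}\cdots u_q^{a_q}$ with $a_i\ge 0$ integers and $a_1+\dots+a_q=s$; $F(J(P_n)^s)$ is the set of all such monomials. For integer vectors, $\mathbf{a}>_{\mathrm{lex}}\mathbf{b}$ means that the first nonzero entry of $\mathbf{a}-\mathbf{b}$ is positive. The expression $M=u_1^{a_1}\cdots u_q^{a_q}$ of $M\in F(J(P_n)^s)$ is the maximal expression if $(a_1,\dots,a_q)>_{\mathrm{lex}}(b_1,\dots,b_q)$ for every other expression $M=u_1^{b_1}\cdots u_q^{b_q}$ of $M$ as an $s$-fold product. The rooted order $>_{\mathcal{R}}$ is the total order on $F(J(P_n)^s)$ given by: if $M=u_1^{a_1}\cdots u_q^{a_q}$ and $N=u_1^{b_1}\cdots u_q^{b_q}$ are maximal expressions, then $M>_{\mathcal{R}}N$ iff $(a_1,\dots,a_q)>_{\mathrm{lex}}(b_1,\dots,b_q)$. The rooted list $\mathcal{R}(J(P_n)^s)=Y_1,\dots,Y_p$ is the list of all elements of $G(J(P_n)^s)$ (a subset of $F(J(P_n)^s)$) ordered so that $Y_1>_{\mathcal{R}}\cdots>_{\mathcal{R}}Y_p$. *)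

theory Defs
  imports "HOL-Algebra.Ideal_Product" "HOL-Library.Poly_Mapping"
begin

text \<open>
  A polynomial with coefficients in a field is a finitely supported map from exponent vectors
  to coefficients, and an exponent vector is a finitely supported map from variable indices to
  natural numbers. This type has infinitely many variables; the ring
  \<open>S = k[x\<^sub>1, \<dots>, x\<^sub>n]\<close> is cut out by the carrier of \<open>poly_ring n\<close>, and all ideals
  below are ideals of that ring.
\<close>

type_synonym 'k mpol = "(nat \<Rightarrow>\<^sub>0 nat) \<Rightarrow>\<^sub>0 'k"

definition monomial :: "(nat \<Rightarrow>\<^sub>0 nat) \<Rightarrow> 'k::field mpol" where
  "monomial m = Poly_Mapping.single m 1"

definition X :: "nat \<Rightarrow> 'k::field mpol" where
  "X i = monomial (Poly_Mapping.single i 1)"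

definition poly_ring :: "nat \<Rightarrow> 'k::field mpol ring" where
  "poly_ring n =
    \<lparr> carrier = {p. \<forall>m \<in> Poly_Mapping.keys p. Poly_Mapping.keys m \<subseteq> {1..n}},
      mult = (*), one = 1, zero = 0, add = (+) \<rparr>"

definition monomials :: "nat \<Rightarrow> 'k::field mpol set" where
  "monomials n = {monomial m | m. Poly_Mapping.keys m \<subseteq> {1..n}}"

definition is_min_mon_gens :: "nat \<Rightarrow> 'k::field mpol set \<Rightarrow> 'k mpol set \<Rightarrow> bool" where
  "is_min_mon_gens n I G \<longleftrightarrow>
     G \<subseteq> monomials n \<and> Idl\<^bsub>poly_ring n\<^esub> G = I \<and> (\<forall>H. H \<subset> G \<longrightarrow> Idl\<^bsub>poly_ring n\<^esub> H \<noteq> I)"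

text \<open>\<open>G(I)\<close>. It is well defined for every monomial ideal, by \<open>ex1_min_mon_gens\<close> below.\<close>

definition min_mon_gens :: "nat \<Rightarrow> 'k::field mpol set \<Rightarrow> 'k mpol set" where
  "min_mon_gens n I = (THE G. is_min_mon_gens n I G)"

definition path_edges :: "nat \<Rightarrow> nat set set" where
  "path_edges n = {{i, i + 1} | i. 1 \<le> i \<and> i + 1 \<le> n}"

text \<open>Intersecting with the carrier yields the unit ideal for a graph without edges.\<close>

definition cover_ideal :: "nat \<Rightarrow> nat set set \<Rightarrow> 'k::field mpol set" where
  "cover_ideal n E = carrier (poly_ring n) \<inter> (\<Inter>e\<in>E. Idl\<^bsub>poly_ring n\<^esub> (X ` e))"

definition ideal_power :: "nat \<Rightarrow> 'k::field mpol set \<Rightarrow> nat \<Rightarrow> 'k mpol set" where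
  "ideal_power n I s = I [^]\<^bsub>ideals_set (poly_ring n)\<^esub> s"

definition ideal_colon :: "nat \<Rightarrow> 'k::field mpol set \<Rightarrow> 'k mpol set \<Rightarrow> 'k mpol set" where
  "ideal_colon n I J = {f \<in> carrier (poly_ring n). \<forall>g\<in>J. f \<otimes>\<^bsub>poly_ring n\<^esub> g \<in> I}"

text \<open>The rooted list of the path; the value at \<open>0\<close> is a dummy that the recursion never reaches
  from an index \<open>n \<ge> 1\<close>.\<close>

fun rooted_list :: "nat \<Rightarrow> 'k::field mpol list" where
  "rooted_list 0 = []"
| "rooted_list (Suc 0) = [1]"
| "rooted_list (Suc (Suc 0)) = [X 1, X 2]"
| "rooted_list (Suc (Suc (Suc 0))) = [X 2, X 1 * X 3]"
| "rooted_list (Suc (Suc (Suc (Suc m)))) =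
     map (\<lambda>u. X (m + 3) * u) (rooted_list (Suc (Suc m))) @
     map (\<lambda>v. X (m + 4) * X (m + 2) * v) (rooted_list (Suc m))"

text \<open>Exponent tuples \<open>(a\<^sub>1, \<dots>, a\<^sub>q)\<close> are lists of length \<open>q\<close>, indexed from \<open>0\<close>.\<close>

definition expressions :: "'k::field mpol list \<Rightarrow> nat \<Rightarrow> 'k mpol \<Rightarrow> nat list set" where
  "expressions us s M =
     {a. length a = length us \<and> sum_list a = s \<and> M = (\<Prod>i<length us. (us ! i) ^ (a ! i))}"

definition lex_gt :: "nat list \<Rightarrow> nat list \<Rightarrow> bool" where
  "lex_gt a b \<longleftrightarrow> (\<exists>k<length a. (\<forall>i<k. a ! i = b ! i) \<and> a ! k > b ! k)"

definition is_max_expression :: "'k::field mpol list \<Rightarrow> nat \<Rightarrow> 'k mpol \<Rightarrow> nat list \<Rightarrow> bool" where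
  "is_max_expression us s M a \<longleftrightarrow>
     a \<in> expressions us s M \<and> (\<forall>b \<in> expressions us s M. b \<noteq> a \<longrightarrow> lex_gt a b)"

definition rooted_gt :: "'k::field mpol list \<Rightarrow> nat \<Rightarrow> 'k mpol \<Rightarrow> 'k mpol \<Rightarrow> bool" where
  "rooted_gt us s M N \<longleftrightarrow>
     (\<exists>a b. is_max_expression us s M a \<and> is_max_expression us s N b \<and> lex_gt a b)"

text \<open>The powers \<open>J(P\<^sub>n)\<^sup>s\<close> and their rooted lists, in decreasing rooted order.\<close>

definition path_cover_power :: "nat \<Rightarrow> nat \<Rightarrow> 'k::field mpol set" where
  "path_cover_power n s = ideal_power n (cover_ideal n (path_edges n)) s"

definition rooted_power_list :: "nat \<Rightarrow> nat \<Rightarrow> 'k::field mpol list" where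
  "rooted_power_list n s =
     (THE Ys. set Ys = min_mon_gens n (path_cover_power n s) \<and>
              sorted_wrt (rooted_gt (rooted_list n) s) Ys)"

text \<open>That \<open>Ys\<close> enumerates the minimal monomial generators of \<open>I\<close> is part of the notion.\<close>

definition has_linear_quotients :: "nat \<Rightarrow> 'k::field mpol set \<Rightarrow> 'k mpol list \<Rightarrow> bool" where
  "has_linear_quotients n I Ys \<longleftrightarrow>
     distinct Ys \<and> set Ys = min_mon_gens n I \<and>
     (\<forall>r \<in> {2..length Ys}. \<exists>V \<subseteq> {1..n}.
        ideal_colon n (Idl\<^bsub>poly_ring n\<^esub> (set (take (r - 1) Ys))) (Idl\<^bsub>poly_ring n\<^esub> {Ys ! (r - 1)})
          = Idl\<^bsub>poly_ring n\<^esub> (X ` V))"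


section \<open>Well-definedness of the minimal monomial generators\<close>

lemma keys_monomial [simp]: "Poly_Mapping.keys (monomial m :: 'k::field mpol) = {m}"
  by (simp add: monomial_def)

lemma monomial_inj [simp]: "(monomial a :: 'k::field mpol) = monomial b \<longleftrightarrow> a = b"
  by (metis keys_monomial singleton_inject)

lemma poly_ring_simps [simp]:
  "mult (poly_ring n) = (*)" "one (poly_ring n) = 1"
  "zero (poly_ring n) = 0" "add (poly_ring n) = (+)"
  by (simp_all add: poly_ring_def)

lemma keys_add_nat:
  "Poly_Mapping.keys (a + b :: nat \<Rightarrow>\<^sub>0 nat) = Poly_Mapping.keys a \<union> Poly_Mapping.keys b"
  by (auto simp: in_keys_iff lookup_add)

lemma mem_poly_ring:
  "p \<in> carrier (poly_ring n) \<longleftrightarrow> (\<forall>m \<in> Poly_Mapping.keys p. Poly_Mapping.keys m \<subseteq> {1..n})"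
  by (simp add: poly_ring_def)

lemma poly_ring_add: "p \<in> carrier (poly_ring n) \<Longrightarrow> q \<in> carrier (poly_ring n) \<Longrightarrow>
    p + q \<in> carrier (poly_ring n)"
  using Poly_Mapping.keys_add[of p q] by (fastforce simp: mem_poly_ring)

lemma poly_ring_mult: "p \<in> carrier (poly_ring n) \<Longrightarrow> q \<in> carrier (poly_ring n) \<Longrightarrow>
    p * q \<in> carrier (poly_ring n)"
  using Poly_Mapping.keys_mult[of p q] keys_add_nat unfolding mem_poly_ring by blast

lemma cring_poly_ring: "cring (poly_ring n :: 'k::field mpol ring)"
proof (rule cringI)
  show "abelian_group (poly_ring n :: 'k mpol ring)"
  proof (rule abelian_groupI)
    fix x :: "'k mpol" assume "x \<in> carrier (poly_ring n)"
    hence "- x \<in> carrier (poly_ring n)" by (simp add: mem_poly_ring)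
    thus "\<exists>y\<in>carrier (poly_ring n). y \<oplus>\<^bsub>poly_ring n\<^esub> x = \<zero>\<^bsub>poly_ring n\<^esub>"
      by (intro bexI[of _ "- x"]) auto
  qed (auto simp: poly_ring_add add_ac, simp add: mem_poly_ring)
  show "comm_monoid (poly_ring n :: 'k mpol ring)"
    by (rule comm_monoidI) (auto simp: poly_ring_mult mult_ac, simp add: mem_poly_ring)
qed (simp add: distrib_right)

lemma monomial_in_monomials [simp]:
  "(monomial m :: 'k::field mpol) \<in> monomials n \<longleftrightarrow> Poly_Mapping.keys m \<subseteq> {1..n}"
  by (auto simp: monomials_def)

lemma monomials_carrier: "monomials n \<subseteq> carrier (poly_ring n)"
  by (auto simp: monomials_def mem_poly_ring)

text \<open>A monomial lies in an ideal generated by monomials iff one of them divides it.\<close>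

lemma mon_in_Idl_iff:
  fixes A :: "'k::field mpol set"
  assumes A: "A \<subseteq> monomials n" and m: "Poly_Mapping.keys m \<subseteq> {1..n}"
  shows "monomial m \<in> Idl\<^bsub>poly_ring n\<^esub> A \<longleftrightarrow> (\<exists>a b. monomial a \<in> A \<and> m = a + b)"
proof
  interpret R: cring "poly_ring n :: 'k mpol ring" by (rule cring_poly_ring)
  have Ac: "A \<subseteq> carrier (poly_ring n)" using A monomials_carrier by blast
  show "monomial m \<in> Idl\<^bsub>poly_ring n\<^esub> A" if "\<exists>a b. monomial a \<in> A \<and> m = a + b"
  proof -
    from that obtain a b where ab: "monomial a \<in> A" "m = a + b" by blast
    have "monomial b \<in> carrier (poly_ring n :: 'k mpol ring)"
      using m ab(2) by (auto simp: mem_poly_ring keys_add_nat)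
    moreover have "monomial a \<in> Idl\<^bsub>poly_ring n\<^esub> A" using R.genideal_self[OF Ac] ab(1) by blast
    ultimately have "monomial a * monomial b \<in> Idl\<^bsub>poly_ring n\<^esub> A"
      using ideal.I_r_closed[OF R.genideal_ideal[OF Ac]] by simp
    thus ?thesis by (simp add: ab(2) monomial_def mult_single)
  qed
  define D where "D = {p \<in> carrier (poly_ring n :: 'k mpol ring).
      \<forall>m \<in> Poly_Mapping.keys p. \<exists>a b. monomial a \<in> A \<and> m = a + b}"
  have Dmult: "x * p \<in> D" if p: "p \<in> D" and x: "x \<in> carrier (poly_ring n)" for p x
  proof -
    have "\<exists>a b. monomial a \<in> A \<and> k = a + b" if k: "k \<in> Poly_Mapping.keys (x * p)" for k
    proof -
      from k Poly_Mapping.keys_mult[of x p] obtain c d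
        where cd: "k = c + d" "d \<in> Poly_Mapping.keys p" by blast
      then obtain a b where "monomial a \<in> A" "d = a + b" using p by (auto simp: D_def)
      thus ?thesis using cd(1) by (metis add.left_commute)
    qed
    thus ?thesis using p x by (auto simp: D_def poly_ring_mult)
  qed
  have "ideal D (poly_ring n)"
  proof (rule idealI)
    show "ring (poly_ring n :: 'k mpol ring)" by (rule R.ring_axioms)
    show "subgroup D (add_monoid (poly_ring n))"
    proof (rule group.subgroupI[OF R.a_group])
      show "D \<noteq> {}" by (auto simp: D_def mem_poly_ring intro!: exI[of _ 0])
      fix p assume p: "p \<in> D"
      have c: "p \<in> carrier (poly_ring n)" using p by (simp add: D_def)
      have "\<ominus>\<^bsub>poly_ring n\<^esub> p = - p"
        using R.minus_equality[of "- p" p] c by (simp add: mem_poly_ring)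
      moreover have "- p \<in> D" using p by (simp add: D_def mem_poly_ring)
      ultimately show "inv\<^bsub>add_monoid (poly_ring n)\<^esub> p \<in> D" by (simp add: a_inv_def)
      fix q assume q: "q \<in> D"
      have "p + q \<in> D"
        using p q Poly_Mapping.keys_add[of p q] by (auto simp: D_def poly_ring_add)
      thus "p \<otimes>\<^bsub>add_monoid (poly_ring n)\<^esub> q \<in> D" by simp
    qed (auto simp: D_def)
  qed (use Dmult in \<open>auto simp: mult.commute\<close>)
  moreover have "A \<subseteq> D"
  proof
    fix p assume p: "p \<in> A"
    then obtain a where "p = monomial a" using A by (auto simp: monomials_def)
    moreover have "a = a + 0" by simp
    ultimately show "p \<in> D" using p Ac unfolding D_def by (auto simp del: add_0_right)
  qed
  ultimately have "Idl\<^bsub>poly_ring n\<^esub> A \<subseteq> D" by (rule R.genideal_minimal)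
  thus "\<exists>a b. monomial a \<in> A \<and> m = a + b" if "monomial m \<in> Idl\<^bsub>poly_ring n\<^esub> A"
    using that by (auto simp: D_def)
qed

lemma add_antisym:
  assumes "g = h + b" "h = g + (c :: nat \<Rightarrow>\<^sub>0 nat)" shows "g = h"
proof (rule poly_mapping_eqI)
  fix k
  have "Poly_Mapping.lookup g k = Poly_Mapping.lookup h k + Poly_Mapping.lookup b k" "Poly_Mapping.lookup h k = Poly_Mapping.lookup g k + Poly_Mapping.lookup c k"
    using assms lookup_add by metis+
  thus "Poly_Mapping.lookup g k = Poly_Mapping.lookup h k" by simp
qed

lemma is_min_mon_gens_subset:
  fixes G H :: "'k::field mpol set"
  assumes G: "is_min_mon_gens n I G" and H: "is_min_mon_gens n I H"
  shows "G \<subseteq> H"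
proof
  interpret R: cring "poly_ring n :: 'k mpol ring" by (rule cring_poly_ring)
  have Gm: "G \<subseteq> monomials n" and Hm: "H \<subseteq> monomials n"
    and GI: "Idl\<^bsub>poly_ring n\<^esub> G = I" and HI: "Idl\<^bsub>poly_ring n\<^esub> H = I"
    using G H by (auto simp: is_min_mon_gens_def)
  have Gc: "G \<subseteq> carrier (poly_ring n)" and Hc: "H \<subseteq> carrier (poly_ring n)"
    using Gm Hm monomials_carrier by blast+
  fix x assume x: "x \<in> G"
  then obtain g where g: "x = monomial g" "Poly_Mapping.keys g \<subseteq> {1..n}"
    using Gm by (auto simp: monomials_def)
  have "monomial g \<in> Idl\<^bsub>poly_ring n\<^esub> H" using R.genideal_self[OF Gc] x g GI HI by blast
  then obtain h b where h: "monomial h \<in> H" "g = h + b" using mon_in_Idl_iff[OF Hm g(2)] by blast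
  have hk: "Poly_Mapping.keys h \<subseteq> {1..n}" using h(1) Hm monomial_in_monomials by blast
  have "monomial h \<in> Idl\<^bsub>poly_ring n\<^esub> G" using R.genideal_self[OF Hc] h(1) GI HI by blast
  then obtain g' c where g': "monomial g' \<in> G" "h = g' + c" using mon_in_Idl_iff[OF Gm hk] by blast
  have "g' = g"
  proof (rule ccontr)
    assume ne: "g' \<noteq> g"
    let ?H = "G - {x}"
    have sub: "?H \<subseteq> monomials n" "?H \<subseteq> carrier (poly_ring n)" using Gm Gc by auto
    have "g = g' + (c + b)" using h(2) g'(2) by (simp add: add.assoc)
    moreover have "monomial g' \<in> ?H" using g'(1) ne g(1) by simp
    ultimately have "x \<in> Idl\<^bsub>poly_ring n\<^esub> ?H" using mon_in_Idl_iff[OF sub(1) g(2)] g(1) by blast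
    hence "G \<subseteq> Idl\<^bsub>poly_ring n\<^esub> ?H" using R.genideal_self[OF sub(2)] by blast
    hence "Idl\<^bsub>poly_ring n\<^esub> G \<subseteq> Idl\<^bsub>poly_ring n\<^esub> ?H"
      by (rule R.genideal_minimal[OF R.genideal_ideal[OF sub(2)]])
    moreover have "Idl\<^bsub>poly_ring n\<^esub> ?H \<subseteq> Idl\<^bsub>poly_ring n\<^esub> G"
      by (rule R.subset_Idl_subset[OF Gc]) blast
    ultimately have "Idl\<^bsub>poly_ring n\<^esub> ?H = I" using GI by blast
    moreover have "?H \<subset> G" using x by blast
    ultimately show False using G by (auto simp: is_min_mon_gens_def)
  qed
  hence "g = h" using add_antisym[OF h(2)] g'(2) by simp
  thus "x \<in> H" using h(1) g(1) by simp
qed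

text \<open>Existence: the members of a monomial generating set that are minimal under divisibility.\<close>

lemma is_min_mon_gens_minimal:
  fixes A :: "'k::field mpol set"
  assumes A: "A \<subseteq> monomials n"
  shows "is_min_mon_gens n (Idl\<^bsub>poly_ring n\<^esub> A)
           {monomial m | m. monomial m \<in> A \<and> (\<forall>a b. monomial a \<in> A \<and> m = a + b \<longrightarrow> a = m)}"
    (is "is_min_mon_gens n _ ?G")
proof -
  interpret R: cring "poly_ring n :: 'k mpol ring" by (rule cring_poly_ring)
  have GA: "?G \<subseteq> A" by blast
  have Gm: "?G \<subseteq> monomials n" using GA A by blast
  have Ac: "A \<subseteq> carrier (poly_ring n)" using A monomials_carrier by blast
  have Gc: "?G \<subseteq> carrier (poly_ring n)" using GA Ac by blast
  define deg where "deg m = (\<Sum>i\<in>{1..n}. Poly_Mapping.lookup m i)" for m :: "nat \<Rightarrow>\<^sub>0 nat"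
  have deg_add: "deg (a + b) = deg a + deg b" for a b
    by (simp only: deg_def lookup_add sum.distrib)
  have deg_0: "b = 0" if "deg b = 0" "Poly_Mapping.keys b \<subseteq> {1..n}" for b
  proof (rule poly_mapping_eqI)
    fix k
    have "\<forall>i\<in>{1..n}. Poly_Mapping.lookup b i = 0" using that(1) by (simp add: deg_def)
    thus "Poly_Mapping.lookup b k = Poly_Mapping.lookup 0 k" using that(2) in_keys_iff[of k b] by auto
  qed
  have below: "\<exists>a b. monomial a \<in> ?G \<and> m = a + b" if "monomial m \<in> A" for m
    using that
  proof (induction "deg m" arbitrary: m rule: less_induct)
    case less
    show ?case
    proof (cases "\<forall>a b. monomial a \<in> A \<and> m = a + b \<longrightarrow> a = m")
      case True
      hence "monomial m \<in> ?G" using less.prems by blast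
      moreover have "m = m + 0" by simp
      ultimately show ?thesis by (intro exI conjI)
    next
      case False
      then obtain a b where ab: "monomial a \<in> A" "m = a + b" "a \<noteq> m" by blast
      have "Poly_Mapping.keys m \<subseteq> {1..n}" using less.prems A monomial_in_monomials by blast
      hence "Poly_Mapping.keys b \<subseteq> {1..n}" using ab(2) by (simp add: keys_add_nat)
      hence "deg b \<noteq> 0" using deg_0[of b] ab by auto
      hence "deg a < deg m" using ab(2) deg_add by simp
      from less.hyps[OF this ab(1)] obtain a' b' where a': "monomial a' \<in> ?G" "a = a' + b'"
        by (elim exE conjE)
      moreover have "m = a' + (b' + b)" using ab(2) a'(2) by (simp add: add.assoc)
      ultimately show ?thesis by (intro exI conjI)
    qed
  qed
  have "A \<subseteq> Idl\<^bsub>poly_ring n\<^esub> ?G"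
  proof
    fix p assume p: "p \<in> A"
    then obtain m where m: "p = monomial m" "Poly_Mapping.keys m \<subseteq> {1..n}"
      using A by (auto simp: monomials_def)
    show "p \<in> Idl\<^bsub>poly_ring n\<^esub> ?G"
      using below[of m] mon_in_Idl_iff[OF Gm m(2)] p m(1) by blast
  qed
  hence eq: "Idl\<^bsub>poly_ring n\<^esub> ?G = Idl\<^bsub>poly_ring n\<^esub> A"
    using R.genideal_minimal[OF R.genideal_ideal[OF Gc]] R.subset_Idl_subset[OF Ac GA] by blast
  have "Idl\<^bsub>poly_ring n\<^esub> H \<noteq> Idl\<^bsub>poly_ring n\<^esub> A" if H: "H \<subset> ?G" for H
  proof
    assume e: "Idl\<^bsub>poly_ring n\<^esub> H = Idl\<^bsub>poly_ring n\<^esub> A"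
    obtain m where m: "monomial m \<in> ?G" "monomial m \<notin> H" using H by blast
    have Hm: "H \<subseteq> monomials n" using H Gm by blast
    have mk: "Poly_Mapping.keys m \<subseteq> {1..n}" using m(1) Gm monomial_in_monomials by blast
    have "monomial m \<in> Idl\<^bsub>poly_ring n\<^esub> H" using e m(1) GA R.genideal_self[OF Ac] by blast
    then obtain a b where ab: "monomial a \<in> H" "m = a + b" using mon_in_Idl_iff[OF Hm mk] by blast
    have "\<forall>a b. monomial a \<in> A \<and> m = a + b \<longrightarrow> a = m" using m(1) by auto
    moreover have "monomial a \<in> A" using ab(1) H GA by blast
    ultimately have "a = m" using ab(2) by blast
    thus False using ab(1) m(2) by simp
  qed
  thus ?thesis using Gm eq by (simp add: is_min_mon_gens_def)
qed

theorem ex1_min_mon_gens: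
  fixes A :: "'k::field mpol set"
  assumes "A \<subseteq> monomials n"
  shows "\<exists>!G. is_min_mon_gens n (Idl\<^bsub>poly_ring n\<^esub> A) G"
  using is_min_mon_gens_minimal[OF assms] is_min_mon_gens_subset by blast

end

theory Submission
  imports Defs
begin

text \<open>
  Identify monomials with exponent vectors. Then \<open>J(P\<^sub>n)\<^sup>s\<close> is spanned by the vectors \<open>a\<close> with
  \<open>a\<^sub>i + a\<^sub>i\<^sub>+\<^sub>1 \<ge> s\<close> on every edge (\<open>s\<close>-covers), and its generators are the minimal \<open>s\<close>-covers.
  The rooted list enumerates the minimal 1-covers by their entry at the largest vertex where they
  differ, and the first factor of the maximal expression of \<open>a\<close> is the greedy cover \<open>C\<close> that,
  from vertex \<open>n\<close> downwards, contains \<open>i\<close> only if \<open>a\<^sub>i \<ge> s\<close> or \<open>i + 1 \<notin> C\<close>; the remaining factors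
  form the maximal expression of the \<open>(s - 1)\<close>-cover \<open>a - C\<close>. So the rooted order
  compares successive greedy covers. If \<open>b\<close> precedes \<open>a\<close> and their greedy covers first differ at
  the vertex \<open>i\<close>, then \<open>b\<^sub>i < a\<^sub>i\<close>, the edge \<open>{i, i + 1}\<close> is slack in \<open>a\<close> and \<open>{i - 1, i}\<close> is tight.
  Hence \<open>b\<^sub>i\<^sub>-\<^sub>1 > a\<^sub>i\<^sub>-\<^sub>1\<close>, and moving one unit of \<open>a\<close> from \<open>i\<close> to \<open>i - 1\<close> gives an \<open>s\<close>-cover that
  precedes \<open>a\<close> and divides \<open>x\<^sub>i\<^sub>-\<^sub>1 a\<close>.
\<close>

section \<open>Exponent vectors and divisibility of monomials\<close>

abbreviation lookup where "lookup \<equiv> Poly_Mapping.lookup"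
abbreviation keys where "keys \<equiv> Poly_Mapping.keys"
definition var :: "nat \<Rightarrow> nat \<Rightarrow>\<^sub>0 nat" where "var i = Poly_Mapping.single i 1"

definition divides :: "(nat \<Rightarrow>\<^sub>0 nat) \<Rightarrow> (nat \<Rightarrow>\<^sub>0 nat) \<Rightarrow> bool" (infix "\<preceq>" 50) where
  "a \<preceq> b \<longleftrightarrow> (\<forall>i. lookup a i \<le> lookup b i)"

lemma divides_refl: "a \<preceq> a" and divides_trans: "a \<preceq> b \<Longrightarrow> b \<preceq> c \<Longrightarrow> a \<preceq> c"
  by (auto simp: divides_def intro: order_trans)

lemma divides_antisym: "a \<preceq> b \<Longrightarrow> b \<preceq> a \<Longrightarrow> a = b"
  by (rule poly_mapping_eqI) (simp add: divides_def order_antisym)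

lemma divides_iff_add: "a \<preceq> b \<longleftrightarrow> (\<exists>c. b = a + c)"
proof
  assume "a \<preceq> b"
  hence "b = a + (b - a)"
    by (intro poly_mapping_eqI) (simp add: divides_def lookup_add lookup_minus)
  thus "\<exists>c. b = a + c" ..
qed (auto simp: divides_def lookup_add)

lemma divides_diff_eq: "a \<preceq> b \<Longrightarrow> a + (b - a) = b"
  by (auto simp: divides_iff_add)

lemma add_divides_cancel: "c + a \<preceq> c + b \<longleftrightarrow> a \<preceq> b"
  by (simp add: divides_def lookup_add)

lemma lookup_var: "lookup (var i) k = (if k = i then 1 else 0)"
  by (simp add: var_def lookup_single when_def)

section \<open>Covers of the path\<close>

text \<open>The inequalities cut out the \<open>s\<close>-th symbolic power of the cover ideal of
  the path; that it equals the ordinary power comes from splitting off greedy covers. The support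
  bound keeps the vectors inside the ring in \<open>n\<close> variables.\<close>

definition is_cover :: "nat \<Rightarrow> nat \<Rightarrow> (nat \<Rightarrow>\<^sub>0 nat) \<Rightarrow> bool" where
  "is_cover n s a \<longleftrightarrow> keys a \<subseteq> {1..n} \<and> (\<forall>i. 1 \<le> i \<and> i < n \<longrightarrow> s \<le> lookup a i + lookup a (Suc i))"

definition min_cover :: "nat \<Rightarrow> nat \<Rightarrow> (nat \<Rightarrow>\<^sub>0 nat) \<Rightarrow> bool" where
  "min_cover n s a \<longleftrightarrow> is_cover n s a \<and> (\<forall>b. is_cover n s b \<and> b \<preceq> a \<longrightarrow> b = a)"

lemma is_cover_keys: "is_cover n s a \<Longrightarrow> keys a \<subseteq> {1..n}"
  by (simp add: is_cover_def)

lemma is_cover_lookup0: "is_cover n s a \<Longrightarrow> \<not> (1 \<le> i \<and> i \<le> n) \<Longrightarrow> lookup a i = 0"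
  using in_keys_iff[of i a] by (auto simp: is_cover_def)

lemma is_coverI:
  assumes "\<And>i. \<not> (1 \<le> i \<and> i \<le> n) \<Longrightarrow> lookup a i = 0"
    and "\<And>i. 1 \<le> i \<Longrightarrow> i < n \<Longrightarrow> s \<le> lookup a i + lookup a (Suc i)"
  shows "is_cover n s a"
  unfolding is_cover_def
proof (intro conjI subsetI allI impI)
  show "i \<in> {1..n}" if "i \<in> keys a" for i
    using that assms(1)[of i] by (auto simp: in_keys_iff)
qed (use assms(2) in simp)

lemma is_cover_edge:
  "is_cover n s a \<Longrightarrow> 1 \<le> i \<Longrightarrow> i < n \<Longrightarrow> s \<le> lookup a i + lookup a (Suc i)"
  by (simp add: is_cover_def)

lemma is_cover_add:
  assumes a: "is_cover n s a" and b: "is_cover n t b" shows "is_cover n (s + t) (a + b)"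
proof (rule is_coverI)
  show "lookup (a + b) i = 0" if "\<not> (1 \<le> i \<and> i \<le> n)" for i
    using is_cover_lookup0[OF a that] is_cover_lookup0[OF b that] by (simp add: lookup_add)
  show "s + t \<le> lookup (a + b) i + lookup (a + b) (Suc i)" if "1 \<le> i" "i < n" for i
    using is_cover_edge[OF a that] is_cover_edge[OF b that] by (simp add: lookup_add)
qed

lemma is_cover_mono:
  assumes "is_cover n s a" "a \<preceq> b" "keys b \<subseteq> {1..n}" shows "is_cover n s b"
  unfolding is_cover_def
proof (intro conjI allI impI)
  fix i assume "1 \<le> i \<and> i < n"
  hence "s \<le> lookup a i + lookup a (Suc i)" using is_cover_edge assms(1) by blast
  moreover have "lookup a i \<le> lookup b i" "lookup a (Suc i) \<le> lookup b (Suc i)"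
    using assms(2) by (simp_all add: divides_def)
  ultimately show "s \<le> lookup b i + lookup b (Suc i)" by linarith
qed (rule assms(3))

lemma min_cover_imp: "min_cover n s a \<Longrightarrow> is_cover n s a"
  by (simp add: min_cover_def)

lemma min_cover_eq: "min_cover n s a \<Longrightarrow> is_cover n s b \<Longrightarrow> b \<preceq> a \<Longrightarrow> b = a"
  by (simp add: min_cover_def)

text \<open>A cover of least degree among those dividing \<open>a\<close> is minimal: anything
  strictly below it would have smaller degree.\<close>

lemma ex_min_cover_below:
  assumes "is_cover n s a"
  obtains b where "min_cover n s b" "b \<preceq> a"
proof -
  define deg where "deg b = (\<Sum>i\<in>{1..n}. lookup b i)" for b :: "nat \<Rightarrow>\<^sub>0 nat"
  obtain b where b: "is_cover n s b \<and> b \<preceq> a"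
    and least: "\<And>c. is_cover n s c \<and> c \<preceq> a \<Longrightarrow> deg b \<le> deg c"
    using ex_has_least_nat[of "\<lambda>b. is_cover n s b \<and> b \<preceq> a" a deg] assms divides_refl by blast
  have "c = b" if c: "is_cover n s c" "c \<preceq> b" for c
  proof (rule poly_mapping_eqI)
    fix k
    have "deg b \<le> deg c" using least b c divides_trans by blast
    moreover have le: "\<forall>i\<in>{1..n}. lookup c i \<le> lookup b i" using c(2) by (simp add: divides_def)
    ultimately have "\<not> (\<exists>i\<in>{1..n}. lookup c i < lookup b i)"
      using sum_strict_mono_ex1[of "{1..n}" "lookup c" "lookup b"] by (auto simp: deg_def)
    thus "lookup c k = lookup b k"
      using le is_cover_lookup0[OF c(1), of k] is_cover_lookup0[of n s b k] b
      by (cases "k \<in> {1..n}") (auto simp: order_antisym not_less)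
  qed
  thus ?thesis using that b by (auto simp: min_cover_def)
qed

text \<open>Shrinking one summand to a smaller cover of the same order would shrink the sum, which
  is minimal.\<close>

lemma min_cover_summands:
  assumes "min_cover n (s + t) (a + b)" "is_cover n s a" "is_cover n t b"
  shows "min_cover n s a" "min_cover n t b"
proof -
  have "c = a" if "is_cover n s c" "c \<preceq> a" for c
  proof -
    have "c + b = a + b"
      using min_cover_eq[OF assms(1) is_cover_add[OF that(1) assms(3)]] that(2)
      by (simp add: add.commute[of _ b] add_divides_cancel)
    thus ?thesis by simp
  qed
  thus "min_cover n s a" using assms(2) by (simp add: min_cover_def)
  have "c = b" if "is_cover n t c" "c \<preceq> b" for c
  proof -
    have "a + c = a + b"
      using min_cover_eq[OF assms(1) is_cover_add[OF assms(2) that(1)]] that(2)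
      by (simp add: add_divides_cancel)
    thus ?thesis by simp
  qed
  thus "min_cover n t b" using assms(3) by (simp add: min_cover_def)
qed

text \<open>If every edge at \<open>i\<close> were slack, lowering the entry at \<open>i\<close> by
  one would keep all inequalities.\<close>

lemma min_cover_tight:
  assumes a: "min_cover n s a" and pos: "lookup a i > 0"
  obtains "i < n" "lookup a i + lookup a (Suc i) = s" | j where "i = Suc j" "1 \<le> j" "lookup a j + lookup a i = s"
proof -
  have c: "is_cover n s a" using a by (rule min_cover_imp)
  have i: "1 \<le> i" "i \<le> n" using is_cover_lookup0[OF c, of i] pos by (metis less_irrefl)+
  let ?b = "a - var i"
  have look: "lookup ?b k = lookup a k - (if k = i then 1 else 0)" for k
    by (simp add: lookup_minus lookup_var)
  have "?b \<noteq> a" using look[of i] pos by (metis diff_less less_irrefl zero_less_one)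
  hence "\<not> is_cover n s ?b"
    using min_cover_eq[OF a, of ?b] by (auto simp: divides_def look)
  then obtain k where k: "1 \<le> k" "k < n" "lookup ?b k + lookup ?b (Suc k) < s"
    using is_coverI[of n ?b s] is_cover_lookup0[OF c] look by (metis diff_0_eq_0 not_le)
  have "s \<le> lookup a k + lookup a (Suc k)" using is_cover_edge[OF c k(1,2)] .
  hence "k = i \<or> Suc k = i" "lookup a k + lookup a (Suc k) = s"
    using k(3) by (auto simp: look split: if_splits)
  thus ?thesis using that k by auto
qed

text \<open>A positive entry lies on a tight edge, whose two entries add up to
  \<open>s\<close>.\<close>

lemma min_cover_bounded:
  assumes "min_cover n s a" shows "lookup a i \<le> s"
proof (cases "lookup a i = 0")
  case False
  hence "lookup a i > 0" by simp
  thus ?thesis by (rule min_cover_tight[OF assms]) auto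
qed simp

lemma finite_min_covers: "finite {a. min_cover n s a}"
proof (rule finite_imageD)
  have "lookup ` {a. min_cover n s a} \<subseteq>
      {f. \<forall>x. (x \<in> {1..n} \<longrightarrow> f x \<in> {..s}) \<and> (x \<notin> {1..n} \<longrightarrow> f x = 0)}"
    using min_cover_bounded is_cover_lookup0[OF min_cover_imp] by fastforce
  thus "finite (lookup ` {a. min_cover n s a})"
    using finite_set_of_finite_funs[of "{1..n}" "{..s}" 0] by (rule finite_subset) auto
  show "inj_on lookup {a. min_cover n s a}" by (auto intro!: inj_onI poly_mapping_eqI)
qed

section \<open>Greedy covers\<close>

text \<open>Vertex \<open>n\<close> is decided by the threshold alone, as if a vertex above it were
  chosen. Above \<open>n\<close> the value is \<open>False\<close>, which gives \<open>row\<close>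
  finite support.\<close>

function in_row :: "nat \<Rightarrow> nat \<Rightarrow> (nat \<Rightarrow>\<^sub>0 nat) \<Rightarrow> nat \<Rightarrow> bool" where
  "in_row n s a i = (if i < n then s \<le> lookup a i \<or> \<not> in_row n s a (Suc i) else i = n \<and> s \<le> lookup a n)"
  by auto
termination by (relation "measure (\<lambda>(n, s, a, i). n - i)") auto

declare in_row.simps [simp del]

lemma in_row_le: "in_row n s a i \<Longrightarrow> i \<le> n"
  using in_row.simps[of n s a i] by (auto split: if_splits)

text \<open>\<open>in_row\<close> is computed at the index 0 too and can hold there; 0 is not a
  vertex, hence the guard \<open>1 \<le> i\<close>.\<close>

definition row :: "nat \<Rightarrow> nat \<Rightarrow> (nat \<Rightarrow>\<^sub>0 nat) \<Rightarrow> nat \<Rightarrow>\<^sub>0 nat" where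
  "row n s a = Abs_poly_mapping (\<lambda>i. if 1 \<le> i \<and> in_row n s a i then 1 else 0)"

lemma lookup_row: "lookup (row n s a) i = (if 1 \<le> i \<and> in_row n s a i then 1 else 0)"
proof -
  have "{i. (if 1 \<le> i \<and> in_row n s a i then 1 else 0 :: nat) \<noteq> 0} \<subseteq> {..n}"
    using in_row_le by (auto split: if_splits)
  hence "finite {i. (if 1 \<le> i \<and> in_row n s a i then 1 else 0 :: nat) \<noteq> 0}"
    by (rule finite_subset) simp
  thus ?thesis unfolding row_def by (subst lookup_Abs_poly_mapping) auto
qed

lemma row_cover: "is_cover n 1 (row n s a)"
proof (rule is_coverI)
  show "lookup (row n s a) i = 0" if "\<not> (1 \<le> i \<and> i \<le> n)" for i
    using that in_row_le[of n s a i] by (auto simp: lookup_row)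
  show "1 \<le> lookup (row n s a) i + lookup (row n s a) (Suc i)" if "1 \<le> i" "i < n" for i
    using that in_row.simps[of n s a i] by (auto simp: lookup_row)
qed

text \<open>A chosen vertex \<open>i\<close> with entry less than \<open>s\<close> has
  \<open>Suc i\<close> unchosen, so the entry at \<open>Suc i\<close> is less than \<open>s\<close>
  as well, and the edge inequality leaves at least one unit at \<open>i\<close>.\<close>

lemma row_divides:
  assumes a: "is_cover n s a" and s: "s \<ge> 1" shows "row n s a \<preceq> a"
  unfolding divides_def
proof
  fix i
  have "lookup a i \<ge> 1" if i: "1 \<le> i" "in_row n s a i"
  proof (cases "s \<le> lookup a i")
    case False
    hence i': "i < n" "\<not> in_row n s a (Suc i)" using i(2) in_row.simps[of n s a i] by (auto split: if_splits)
    hence "lookup a (Suc i) < s" using in_row.simps[of n s a "Suc i"] by (cases "Suc i = n") (auto split: if_splits)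
    thus ?thesis using is_cover_edge[OF a i(1) i'(1)] by linarith
  qed (use s in simp)
  thus "lookup (row n s a) i \<le> lookup a i" by (simp add: lookup_row)
qed

text \<open>An edge loses two units only when both ends are chosen. Then the lower end was chosen by
  the threshold, and its entry alone still reaches \<open>s\<close>.\<close>

lemma row_diff_cover:
  assumes a: "is_cover n (Suc s) a" shows "is_cover n s (a - row n (Suc s) a)"
proof (rule is_coverI)
  let ?C = "row n (Suc s) a"
  have C: "lookup ?C i \<le> lookup a i" for i
    using row_divides[OF a] by (simp add: divides_def)
  show "lookup (a - ?C) i = 0" if "\<not> (1 \<le> i \<and> i \<le> n)" for i
    using is_cover_lookup0[OF a that] by (simp add: lookup_minus)
  fix i assume i: "1 \<le> i" "i < n"
  have e: "Suc s \<le> lookup a i + lookup a (Suc i)" using is_cover_edge[OF a i] .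
  show "s \<le> lookup (a - ?C) i + lookup (a - ?C) (Suc i)"
  proof (cases "in_row n (Suc s) a i \<and> in_row n (Suc s) a (Suc i)")
    case True
    hence "Suc s \<le> lookup a i" using in_row.simps[of n "Suc s" a i] i by auto
    thus ?thesis using True C[of "Suc i"] i(1) by (simp add: lookup_minus lookup_row)
  next
    case False
    hence "lookup ?C i + lookup ?C (Suc i) \<le> 1" by (auto simp: lookup_row)
    thus ?thesis using e C[of i] C[of "Suc i"] by (simp add: lookup_minus)
  qed
qed

lemma min_cover_row:
  assumes a: "min_cover n (Suc s) a"
  shows "min_cover n 1 (row n (Suc s) a)" "min_cover n s (a - row n (Suc s) a)"
proof -
  have c: "is_cover n (Suc s) a" using a by (rule min_cover_imp)
  have eq: "row n (Suc s) a + (a - row n (Suc s) a) = a"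
    using row_divides[OF c] by (simp add: divides_diff_eq)
  have "min_cover n (1 + s) (row n (Suc s) a + (a - row n (Suc s) a))" using a eq by simp
  thus "min_cover n 1 (row n (Suc s) a)" "min_cover n s (a - row n (Suc s) a)"
    using min_cover_summands row_cover row_diff_cover[OF c] by blast+
qed

section \<open>Comparing vectors at their largest difference, and comparing greedy rows\<close>

definition top_lt :: "(nat \<Rightarrow>\<^sub>0 nat) \<Rightarrow> (nat \<Rightarrow>\<^sub>0 nat) \<Rightarrow> bool" (infix "\<prec>" 50) where
  "a \<prec> b \<longleftrightarrow> (\<exists>i. lookup a i < lookup b i \<and> (\<forall>k>i. lookup a k = lookup b k))"

lemma top_lt_irrefl: "\<not> a \<prec> a"
  by (simp add: top_lt_def)

lemma top_lt_trans: 
  assumes "a \<prec> b" "b \<prec> c" shows "a \<prec> c"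
proof -
  obtain i j where i: "lookup a i < lookup b i" "\<forall>k>i. lookup a k = lookup b k"
    and j: "lookup b j < lookup c j" "\<forall>k>j. lookup b k = lookup c k"
    using assms by (auto simp: top_lt_def)
  have "lookup a (max i j) < lookup c (max i j)"
    using i j by (cases i j rule: linorder_cases) auto
  thus ?thesis using i j unfolding top_lt_def by (intro exI[of _ "max i j"]) auto
qed

lemma ex_top_difference:
  assumes "a \<noteq> b"
  obtains i where "lookup a i \<noteq> lookup b i" "\<forall>k>i. lookup a k = lookup (b :: nat \<Rightarrow>\<^sub>0 nat) k"
proof -
  let ?D = "{i. lookup a i \<noteq> lookup b i}"
  have "?D \<subseteq> keys a \<union> keys b" by (auto simp: in_keys_iff)
  hence fin: "finite ?D" by (rule finite_subset) simp
  have ne: "?D \<noteq> {}" using assms by (auto intro: poly_mapping_eqI)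
  show ?thesis using that[of "Max ?D"] Max_in[OF fin ne] Max_ge[OF fin] by fastforce
qed

lemma top_lt_total:
  assumes "a \<noteq> b" shows "a \<prec> b \<or> b \<prec> a"
proof -
  obtain i where "lookup a i \<noteq> lookup b i" "\<forall>k>i. lookup a k = lookup b k"
    using ex_top_difference[OF assms] by blast
  thus ?thesis unfolding top_lt_def by (cases "lookup a i < lookup b i") (auto simp: not_less le_less)
qed

text \<open>At the largest vertex \<open>i\<close> where the rows differ, they agree at
  \<open>Suc i\<close>. If \<open>i < n\<close> and \<open>Suc i\<close> were unchosen, both rows
  would contain \<open>i\<close>; so only the threshold \<open>s\<close> decides the membership of
  \<open>i\<close>.\<close>

lemma row_top_difference:
  assumes "row n s a \<noteq> row n s b"
  obtains i where "1 \<le> i" "i \<le> n" "(lookup a i < s) \<noteq> (lookup b i < s)"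
    "i < n \<longrightarrow> in_row n s a (Suc i)" "i < n \<longrightarrow> in_row n s b (Suc i)"
    "lookup (row n s a) i = (if lookup a i < s then 0 else 1)"
    "lookup (row n s b) i = (if lookup b i < s then 0 else 1)"
    "\<forall>k>i. lookup (row n s a) k = lookup (row n s b) k"
proof -
  obtain i where i: "lookup (row n s a) i \<noteq> lookup (row n s b) i"
    and above: "\<forall>k>i. lookup (row n s a) k = lookup (row n s b) k"
    using ex_top_difference[OF assms] by blast
  have d: "1 \<le> i" "in_row n s a i \<noteq> in_row n s b i"
    using i by (auto simp: lookup_row split: if_splits)
  hence le: "i \<le> n" using in_row_le by blast
  have same: "in_row n s a (Suc i) = in_row n s b (Suc i)"
    using above[rule_format, of "Suc i"] by (auto simp: lookup_row split: if_splits)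
  have sa: "in_row n s a i = (s \<le> lookup a i)" and sb: "in_row n s b i = (s \<le> lookup b i)"
    and up: "i < n \<Longrightarrow> in_row n s a (Suc i)" "i < n \<Longrightarrow> in_row n s b (Suc i)"
    using d(2) le same in_row.simps[of n s a i] in_row.simps[of n s b i] by (auto split: if_splits)
  show ?thesis
    by (rule that[of i]) (use d le sa sb up above in \<open>auto simp: lookup_row not_less\<close>)
qed

text \<open>At the top difference the entries are compared with \<open>s\<close> only, so it is the
  row of the smaller vector that misses the vertex.\<close>

lemma row_antimono:
  assumes "a \<preceq> b" shows "row n s a = row n s b \<or> row n s a \<prec> row n s b"
proof (cases "row n s a = row n s b")
  case False
  then obtain i where "(lookup a i < s) \<noteq> (lookup b i < s)"
    "lookup (row n s a) i = (if lookup a i < s then 0 else 1)"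
    "lookup (row n s b) i = (if lookup b i < s then 0 else 1)"
    "\<forall>k>i. lookup (row n s a) k = lookup (row n s b) k" by (rule row_top_difference)
  moreover have "lookup a i \<le> lookup b i" using assms by (simp add: divides_def)
  ultimately have "row n s a \<prec> row n s b"
    unfolding top_lt_def by (intro exI[of _ i]) (auto split: if_splits)
  thus ?thesis ..
qed simp

text \<open>Stated for arbitrary vectors, since the exchange below first yields a cover that may
  fail to be minimal. At \<open>s = 0\<close> nothing remains to compare: the only minimal 0-cover
  is the zero vector.\<close>

primrec greedy_gt :: "nat \<Rightarrow> nat \<Rightarrow> (nat \<Rightarrow>\<^sub>0 nat) \<Rightarrow> (nat \<Rightarrow>\<^sub>0 nat) \<Rightarrow> bool" where
  "greedy_gt n 0 a b = False"
| "greedy_gt n (Suc s) a b \<longleftrightarrow> row n (Suc s) a \<prec> row n (Suc s) b \<or>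
     row n (Suc s) a = row n (Suc s) b \<and> greedy_gt n s (a - row n (Suc s) a) (b - row n (Suc s) b)"

lemma greedy_gt_total:
  assumes "min_cover n s a" "min_cover n s b" "a \<noteq> b"
  shows "greedy_gt n s a b \<or> greedy_gt n s b a"
  using assms
proof (induction s arbitrary: a b)
  case 0
  have "a = b" using 0 min_cover_bounded[of n 0] by (intro poly_mapping_eqI) simp
  thus ?case using 0 by simp
next
  case (Suc s)
  show ?case
  proof (cases "row n (Suc s) a = row n (Suc s) b")
    case True
    have "row n (Suc s) a \<preceq> a" "row n (Suc s) b \<preceq> b"
      using row_divides[OF min_cover_imp[OF Suc.prems(1)]] row_divides[OF min_cover_imp[OF Suc.prems(2)]]
      by simp_all
    hence "a - row n (Suc s) a \<noteq> b - row n (Suc s) b"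
      using Suc.prems(3) True divides_diff_eq by metis
    hence "greedy_gt n s (a - row n (Suc s) a) (b - row n (Suc s) b) \<or>
        greedy_gt n s (b - row n (Suc s) b) (a - row n (Suc s) a)"
      by (intro Suc.IH min_cover_row(2) Suc.prems)
    thus ?thesis using True by auto
  next
    case False
    thus ?thesis using top_lt_total unfolding greedy_gt.simps by blast
  qed
qed

lemma divides_diff_mono: "a \<preceq> b \<Longrightarrow> a - c \<preceq> b - c"
  by (simp add: divides_def lookup_minus diff_le_mono)

text \<open>This allows the exchanged cover to be shrunk to a minimal one. A divisor has an earlier
  or equal first row, and if the rows are equal, its remainder divides the other remainder.\<close>

lemma greedy_gt_divisor:
  assumes "greedy_gt n s d a" "c \<preceq> d" shows "greedy_gt n s c a"
  using assms
proof (induction s arbitrary: a c d)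
  case (Suc s)
  consider "row n (Suc s) c \<prec> row n (Suc s) d" | "row n (Suc s) c = row n (Suc s) d"
    using row_antimono[OF Suc.prems(2)] by blast
  thus ?case
  proof cases
    case 1
    have "row n (Suc s) d \<prec> row n (Suc s) a \<or> row n (Suc s) d = row n (Suc s) a"
      using Suc.prems(1) by auto
    hence "row n (Suc s) c \<prec> row n (Suc s) a"
      using 1 top_lt_trans by metis
    thus ?thesis by simp
  next
    case 2
    have "greedy_gt n s (c - row n (Suc s) d) (a - row n (Suc s) a)"
      if "greedy_gt n s (d - row n (Suc s) d) (a - row n (Suc s) a)"
      using Suc.IH[OF that divides_diff_mono[OF Suc.prems(2)]] .
    thus ?thesis using Suc.prems(1) unfolding greedy_gt.simps 2 by blast
  qed
qed simp

text \<open>Where the greedy rows of \<open>a\<close> and \<open>b\<close> first differ, say at the vertex \<open>i\<close>, minimality of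
  \<open>a\<close> forces \<open>a\<^sub>i = s\<close> and \<open>a\<^sub>i\<^sub>-\<^sub>1 = 0\<close>, and one unit can be moved from \<open>i\<close> to \<open>i - 1\<close>.\<close>

lemma greedy_exchange:
  assumes "greedy_gt n s b a" "is_cover n s b" "min_cover n s a"
  shows "\<exists>j c. lookup a j < lookup b j \<and> is_cover n s c \<and> (\<forall>i. lookup c i \<le> s) \<and>
           c \<preceq> a + var j \<and> greedy_gt n s c a"
  using assms
proof (induction s arbitrary: a b)
  case (Suc s)
  let ?A = "row n (Suc s) a" and ?B = "row n (Suc s) b"
  have ac: "is_cover n (Suc s) a" using Suc.prems(3) by (rule min_cover_imp)
  have A: "?A \<preceq> a" and B: "?B \<preceq> b"
    using row_divides[OF ac] row_divides[OF Suc.prems(2)] by simp_all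
  show ?case
  proof (cases "?B = ?A")
    case True
    hence "greedy_gt n s (b - ?A) (a - ?A)" using Suc.prems(1) by (simp add: top_lt_irrefl)
    moreover have "is_cover n s (b - ?A)" using row_diff_cover[OF Suc.prems(2)] True by simp
    ultimately obtain j c where jc: "lookup (a - ?A) j < lookup (b - ?A) j" "is_cover n s c"
        "\<forall>i. lookup c i \<le> s" "c \<preceq> a - ?A + var j" "greedy_gt n s c (a - ?A)"
      using Suc.IH min_cover_row(2)[OF Suc.prems(3)] by blast
    \<comment> \<open>The exchange found in the remainders is carried back by adding the common
      row.\<close>
    let ?c = "?A + c"
    have "lookup a j < lookup b j" using jc(1) by (simp add: lookup_minus)
    moreover have "is_cover n (Suc s) ?c" using is_cover_add[OF row_cover jc(2)] by simp
    \<comment> \<open>The bound stands in the claim because \<open>c\<close> need not be minimal,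
      while the comparison of rows below relies on the bound for \<open>c\<close>.\<close>
    moreover have "lookup ?c i \<le> Suc s" for i
      using jc(3)[rule_format, of i] by (simp add: lookup_add lookup_row)
    moreover have "?c \<preceq> a + var j"
    proof -
      have "?c \<preceq> ?A + (a - ?A + var j)" using jc(4) by (simp add: add_divides_cancel)
      thus ?thesis using divides_diff_eq[OF A] by (simp add: add.assoc[symmetric])
    qed
    moreover have "greedy_gt n (Suc s) ?c a"
    proof (cases "row n (Suc s) ?c = ?A")
      case True
      thus ?thesis using jc(5) by simp
    next
      case False
      then obtain i where i: "1 \<le> i" "(lookup ?c i < Suc s) \<noteq> (lookup a i < Suc s)"
        "lookup (row n (Suc s) ?c) i = (if lookup ?c i < Suc s then 0 else 1)"
        "lookup ?A i = (if lookup a i < Suc s then 0 else 1)"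
        "\<forall>k>i. lookup (row n (Suc s) ?c) k = lookup ?A k" by (rule row_top_difference)
      \<comment> \<open>Off \<open>?A\<close> this entry is an entry of \<open>c\<close>, hence at
        most \<open>s\<close>. On \<open>?A\<close> the entry of \<open>a\<close> reaches
        \<open>Suc s\<close>, so that of \<open>?c\<close> does not.\<close>
      have "lookup ?c i < Suc s"
        using i(2,4) jc(3)[rule_format, of i] by (auto simp: lookup_add split: if_splits)
      hence "row n (Suc s) ?c \<prec> ?A" using i unfolding top_lt_def by (intro exI[of _ i]) auto
      thus ?thesis by simp
    qed
    ultimately show ?thesis by blast
  next
    case False
    hence lt: "?B \<prec> ?A" using Suc.prems(1) by simp
    obtain i where i: "1 \<le> i" "i \<le> n" "(lookup b i < Suc s) \<noteq> (lookup a i < Suc s)"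
        "i < n \<longrightarrow> in_row n (Suc s) b (Suc i)" "i < n \<longrightarrow> in_row n (Suc s) a (Suc i)"
        "lookup ?B i = (if lookup b i < Suc s then 0 else 1)"
        "lookup ?A i = (if lookup a i < Suc s then 0 else 1)"
        "\<forall>k>i. lookup ?B k = lookup ?A k"
      using False by (rule row_top_difference)
    \<comment> \<open>Since \<open>?B\<close> comes first, it is the row that misses
      \<open>i\<close>.\<close>
    have "lookup b i < Suc s \<and> \<not> lookup a i < Suc s"
    proof (rule ccontr)
      assume "\<not> ?thesis"
      hence "?A \<prec> ?B" using i unfolding top_lt_def by (intro exI[of _ i]) auto
      thus False using lt top_lt_trans top_lt_irrefl by blast
    qed
    hence bi: "lookup b i < Suc s" and ai: "lookup a i = Suc s"
      using min_cover_bounded[OF Suc.prems(3), of i] by auto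
    \<comment> \<open>A vertex above \<open>i\<close> lies in \<open>?A\<close>, which divides
      \<open>a\<close>. So the edge above \<open>i\<close> is slack, the tight edge at
      \<open>i\<close> goes down to \<open>j\<close>, and the full entry at \<open>i\<close> leaves
      0 at \<open>j\<close>.\<close>
    have up: "lookup a (Suc i) > 0" if "i < n"
      using A i(5) that unfolding divides_def
      by (metis lookup_row One_nat_def Suc_le_eq le_add1 plus_1_eq_Suc)
    have "lookup a i > 0" using ai by simp
    then obtain j where j: "i = Suc j" "1 \<le> j" "lookup a j = 0"
      by (rule min_cover_tight[OF Suc.prems(3)]) (use ai up in auto)
    have bj: "lookup a j < lookup b j"
      using is_cover_edge[OF Suc.prems(2) j(2)] i(2) j bi by simp
    \<comment> \<open>One unit moves from \<open>i\<close> to \<open>j\<close>. Only the edge above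
      \<open>i\<close> loses weight, and it had a unit to spare.\<close>
    let ?c = "a - var i + var j"
    have c: "lookup ?c k = (if k = i then s else if k = j then 1 else lookup a k)" for k
      using ai j by (simp add: lookup_add lookup_minus lookup_var)
    have "is_cover n (Suc s) ?c"
    proof (rule is_coverI)
      show "lookup ?c k = 0" if "\<not> (1 \<le> k \<and> k \<le> n)" for k
      proof -
        have "k \<noteq> i" "k \<noteq> j" using that i(1,2) j(1,2) by auto
        thus ?thesis using is_cover_lookup0[OF ac that] unfolding c by simp
      qed
      fix k assume k: "1 \<le> k" "k < n"
      have e: "Suc s \<le> lookup a k + lookup a (Suc k)" using is_cover_edge[OF ac k] .
      consider "k = i" | "k = j" | "k \<noteq> i" "Suc k \<noteq> i" using j(1) by blast
      thus "Suc s \<le> lookup ?c k + lookup ?c (Suc k)"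
      proof cases
        case 1
        have "lookup ?c i = s" "lookup ?c (Suc i) = lookup a (Suc i)"
          unfolding c using j(1) by simp_all
        thus ?thesis using 1 up k(2) by simp
      next
        case 2
        have "lookup ?c j = 1" "lookup ?c i = s" unfolding c using j(1) by simp_all
        thus ?thesis using 2 j(1) by simp
      next
        case 3
        hence "lookup ?c k \<ge> lookup a k" "lookup ?c (Suc k) \<ge> lookup a (Suc k)"
          unfolding c using j(3) by auto
        thus ?thesis using e by linarith
      qed
    qed
    moreover have "\<forall>k. lookup ?c k \<le> Suc s"
      using min_cover_bounded[OF Suc.prems(3)] by (simp add: c)
    moreover have "?c \<preceq> a + var j"
      by (simp add: divides_def lookup_add lookup_minus)
    moreover have "greedy_gt n (Suc s) ?c a"
    proof -
      \<comment> \<open>The vectors \<open>?c\<close> and \<open>a\<close> agree above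
        \<open>i\<close>, hence so do their rows. At \<open>i\<close> the entry has dropped to
        \<open>s\<close>, and \<open>i\<close> leaves the row.\<close>
      have above: "in_row n (Suc s) ?c k = in_row n (Suc s) a k" if "i < k" for k
        using that
      proof (induction "n - k" arbitrary: k)
        case 0
        hence "lookup ?c k = lookup a k" unfolding c using j(1) by simp
        thus ?case using 0 unfolding in_row.simps[of _ _ _ k] by (cases "k = n") simp_all
      next
        case (Suc d)
        have "in_row n (Suc s) ?c (Suc k) = in_row n (Suc s) a (Suc k)"
          by (rule Suc.hyps) (use Suc in auto)
        moreover have "lookup ?c k = lookup a k" unfolding c using Suc.prems j(1) by simp
        ultimately show ?case using Suc.hyps(2) unfolding in_row.simps[of _ _ _ k] by (cases "k = n") auto
      qed
      have "lookup ?c i = s" unfolding c by simp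
      hence "\<not> in_row n (Suc s) ?c i"
        using above[of "Suc i"] i(2,5) unfolding in_row.simps[of _ _ _ i] by auto
      hence "row n (Suc s) ?c \<prec> ?A"
        unfolding top_lt_def using above i(1) ai i(7)
        by (intro exI[of _ i]) (simp add: lookup_row)
      thus ?thesis by simp
    qed
    ultimately show ?thesis using bj by blast
  qed
qed simp

text \<open>Cutting the exchanged cover down to a minimal one preserves both divisibility and
  precedence; \<open>j\<close> is a vertex because \<open>b\<close> is positive there.\<close>

corollary greedy_exchange_min:
  assumes "greedy_gt n s b a" "min_cover n s b" "min_cover n s a"
  obtains j c where "1 \<le> j" "j \<le> n" "lookup a j < lookup b j" "min_cover n s c" "c \<preceq> a + var j"
    "greedy_gt n s c a"
proof -
  obtain j d where d: "lookup a j < lookup b j" "is_cover n s d" "d \<preceq> a + var j" "greedy_gt n s d a"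
    using greedy_exchange[OF assms(1) min_cover_imp[OF assms(2)] assms(3)] by blast
  obtain c where c: "min_cover n s c" "c \<preceq> d" using ex_min_cover_below[OF d(2)] by blast
  have "1 \<le> j \<and> j \<le> n"
    using is_cover_lookup0[OF min_cover_imp[OF assms(2)], of j] d(1) by fastforce
  thus ?thesis
    using that d c divides_trans[OF c(2) d(3)] greedy_gt_divisor[OF d(4) c(2)] by blast
qed

section \<open>The rooted list\<close>

fun rooted_exps :: "nat \<Rightarrow> (nat \<Rightarrow>\<^sub>0 nat) list" where
  "rooted_exps 0 = []"
| "rooted_exps (Suc 0) = [0]"
| "rooted_exps (Suc (Suc 0)) = [var 1, var 2]"
| "rooted_exps (Suc (Suc (Suc 0))) = [var 2, var 1 + var 3]"
| "rooted_exps (Suc (Suc (Suc (Suc m)))) =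
     map (\<lambda>u. var (m + 3) + u) (rooted_exps (Suc (Suc m))) @
     map (\<lambda>v. var (m + 4) + var (m + 2) + v) (rooted_exps (Suc m))"

lemma monomial_add: "(monomial (a + b) :: 'k::field mpol) = monomial a * monomial b"
  by (simp add: monomial_def mult_single)

lemma monomial_0: "(monomial 0 :: 'k::field mpol) = 1"
  by (simp add: monomial_def)

lemma X_eq_monomial: "X i = monomial (var i)"
  by (simp add: X_def var_def)

lemma rooted_list_eq: "(rooted_list n :: 'k::field mpol list) = map monomial (rooted_exps n)"
proof (induction n rule: rooted_exps.induct)
  case (5 m)
  thus ?case unfolding rooted_list.simps rooted_exps.simps
    by (simp only: map_append map_map o_def monomial_add X_eq_monomial)
qed (simp_all add: monomial_0 X_eq_monomial monomial_add)

text \<open>By the second assumption all covers below \<open>w + u\<close> contain \<open>w\<close>,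
  so minimality can be tested after cancelling \<open>w\<close>. Both branches of the rooted
  recursion are instances.\<close>

lemma min_cover_translate:
  assumes "\<And>b. is_cover m t b \<Longrightarrow> is_cover n s (w + b)"
    and "\<And>c. is_cover n s c \<Longrightarrow> c \<preceq> w + u \<Longrightarrow> \<exists>b. is_cover m t b \<and> c = w + b"
  shows "min_cover n s (w + u) \<longleftrightarrow> min_cover m t u"
proof
  assume min: "min_cover n s (w + u)"
  obtain b where "is_cover m t b" "w + u = w + b"
    using assms(2)[OF min_cover_imp[OF min] divides_refl] by blast
  hence "is_cover m t u" by simp
  moreover have "b = u" if "is_cover m t b" "b \<preceq> u" for b
    using min_cover_eq[OF min assms(1)[OF that(1)]] that(2) by (simp add: add_divides_cancel)
  ultimately show "min_cover m t u" by (simp add: min_cover_def)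
next
  assume min: "min_cover m t u"
  have "c = w + u" if c: "is_cover n s c" "c \<preceq> w + u" for c
  proof -
    obtain b where b: "is_cover m t b" "c = w + b" using assms(2)[OF c] by blast
    hence "b = u" using min_cover_eq[OF min b(1)] c(2) by (simp add: add_divides_cancel)
    thus ?thesis using b(2) by simp
  qed
  thus "min_cover n s (w + u)" using assms(1)[OF min_cover_imp[OF min]] by (simp add: min_cover_def)
qed

section \<open>Minimal vertex covers of short paths, and their recursion\<close>

lemma min_cover_short: "n \<le> 1 \<Longrightarrow> min_cover n s a \<longleftrightarrow> a = 0"
proof -
  assume n: "n \<le> 1"
  have z: "is_cover n s 0" using n by (intro is_coverI) auto
  have le: "0 \<preceq> a" by (simp add: divides_def)
  show ?thesis
  proof
    show "a = 0" if "min_cover n s a" using min_cover_eq[OF that z le] by simp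
    show "min_cover n s a" if "a = 0"
      using z that divides_antisym by (auto simp: min_cover_def divides_def)
  qed
qed

lemma min_cover_two: "min_cover 2 1 a \<longleftrightarrow> a = var 1 \<or> a = var 2"
proof -
  have c: "is_cover 2 1 (var i)" if "i = 1 \<or> i = 2" for i
    using that by (intro is_coverI) (auto simp: lookup_var)
  have min: "min_cover 2 1 (var i)" if i: "i = 1 \<or> i = 2" for i
  proof -
    have "b = var i" if b: "is_cover 2 1 b" "b \<preceq> var i" for b
    proof (rule divides_antisym[OF b(2)])
      have "lookup b k = 0" if "k \<noteq> i" for k
        using b(2) that unfolding divides_def lookup_var by (metis le_zero_eq)
      moreover have "1 \<le> lookup b 1 + lookup b 2"
        using is_cover_edge[OF b(1), of 1] by (simp add: numeral_2_eq_2)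
      ultimately have "1 \<le> lookup b i" using i by fastforce
      thus "var i \<preceq> b" by (simp add: divides_def lookup_var)
    qed
    thus ?thesis using c[OF i] by (simp add: min_cover_def)
  qed
  have "a = var 1 \<or> a = var 2" if a: "min_cover 2 1 a"
  proof -
    have "1 \<le> lookup a 1 + lookup a 2"
      using is_cover_edge[OF min_cover_imp[OF a], of 1] by (simp add: numeral_2_eq_2)
    hence "1 \<le> lookup a 1 \<or> 1 \<le> lookup a 2" by linarith
    then obtain i where i: "i = 1 \<or> i = 2" "1 \<le> lookup a i" by blast
    hence "var i \<preceq> a" by (simp add: divides_def lookup_var)
    thus ?thesis using min_cover_eq[OF a c[OF i(1)]] i(1) by auto
  qed
  thus ?thesis using min by auto
qed

text \<open>The vertex \<open>m + 2\<close> covers the last two edges and leaves the path on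
  \<open>m + 1\<close> vertices. The support condition is a conjunct so that the equivalence holds
  for every \<open>u\<close>.\<close>

lemma min_cover_add_second_last:
  "min_cover (m + 3) 1 (var (m + 2) + u) \<and> keys u \<subseteq> {1..m + 1} \<longleftrightarrow> min_cover (m + 1) 1 u"
proof (cases "keys u \<subseteq> {1..m + 1}")
  case True
  have u0: "lookup u k = 0" if "k > m + 1" for k
    using True that by (auto simp: in_keys_iff)
  have "min_cover (m + 3) 1 (var (m + 2) + u) \<longleftrightarrow> min_cover (m + 1) 1 u"
  proof (rule min_cover_translate)
    fix b assume b: "is_cover (m + 1) 1 b"
    show "is_cover (m + 3) 1 (var (m + 2) + b)"
    proof (rule is_coverI)
      show "lookup (var (m + 2) + b) i = 0" if "\<not> (1 \<le> i \<and> i \<le> m + 3)" for i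
        using that is_cover_lookup0[OF b, of i] by (auto simp: lookup_add lookup_var)
      fix i assume i: "1 \<le> i" "i < m + 3"
      consider "i < m + 1" | "i = m + 1" | "i = m + 2" using i by linarith
      thus "1 \<le> lookup (var (m + 2) + b) i + lookup (var (m + 2) + b) (Suc i)"
      proof cases
        case 1
        thus ?thesis using is_cover_edge[OF b i(1)] by (simp add: lookup_add)
      qed (simp_all add: lookup_add lookup_var)
    qed
  next
    fix c assume c: "is_cover (m + 3) 1 c" "c \<preceq> var (m + 2) + u"
    have le: "lookup c k \<le> (if k = m + 2 then 1 else 0) + lookup u k" for k
      using c(2) unfolding divides_def lookup_add lookup_var by blast
    \<comment> \<open>A divisor of the sum vanishes at the last vertex, so the last edge forces
      \<open>m + 2\<close>.\<close>
    have "lookup c (m + 3) = 0" using le[of "m + 3"] u0 by simp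
    moreover have "lookup c (m + 2) \<le> 1" using le[of "m + 2"] u0 by simp
    moreover have "1 \<le> lookup c (m + 2) + lookup c (m + 3)"
      using is_cover_edge[OF c(1), of "m + 2"] by (simp add: numeral_3_eq_3)
    ultimately have one: "lookup c (m + 2) = 1" by simp
    let ?b = "c - var (m + 2)"
    have b: "lookup ?b k = (if k = m + 2 then 0 else lookup c k)" for k
      using one by (simp add: lookup_minus lookup_var)
    have "c = var (m + 2) + ?b"
      using one by (intro poly_mapping_eqI) (simp add: lookup_add lookup_minus lookup_var)
    moreover have "is_cover (m + 1) 1 ?b"
    proof (rule is_coverI)
      fix i assume i: "\<not> (1 \<le> i \<and> i \<le> m + 1)"
      show "lookup ?b i = 0"
      proof (cases "i = 0")
        case True
        thus ?thesis using is_cover_lookup0[OF c(1), of 0] unfolding b by simp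
      next
        case False
        hence "i > m + 1" using i by simp
        thus ?thesis using le[of i] u0[of i] unfolding b by (auto split: if_splits)
      qed
    next
      fix i assume "1 \<le> i" "i < m + 1"
      thus "1 \<le> lookup ?b i + lookup ?b (Suc i)"
        using is_cover_edge[OF c(1), of i] unfolding b by simp
    qed
    ultimately show "\<exists>b. is_cover (m + 1) 1 b \<and> c = var (m + 2) + b" by blast
  qed
  thus ?thesis using True by simp
next
  case False
  thus ?thesis using is_cover_keys min_cover_imp by blast
qed

text \<open>The vertices \<open>m + 1\<close> and \<open>m + 3\<close> cover every edge that meets a
  vertex above \<open>m\<close>, which leaves the path on \<open>m\<close> vertices.\<close>

lemma min_cover_add_last:
  "min_cover (m + 3) 1 (var (m + 3) + var (m + 1) + v) \<and> keys v \<subseteq> {1..m} \<longleftrightarrow> min_cover m 1 v"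
proof (cases "keys v \<subseteq> {1..m}")
  case True
  have v0: "lookup v k = 0" if "k > m" for k
    using True that by (auto simp: in_keys_iff)
  let ?w = "var (m + 3) + var (m + 1)"
  have w: "lookup ?w k = (if k = m + 3 \<or> k = m + 1 then 1 else 0)" for k
    by (simp add: lookup_add lookup_var)
  have "min_cover (m + 3) 1 (?w + v) \<longleftrightarrow> min_cover m 1 v"
  proof (rule min_cover_translate)
    fix b assume b: "is_cover m 1 b"
    show "is_cover (m + 3) 1 (?w + b)"
    proof (rule is_coverI)
      fix i assume i: "\<not> (1 \<le> i \<and> i \<le> m + 3)"
      hence "lookup b i = 0" using is_cover_lookup0[OF b, of i] by auto
      moreover have "i \<noteq> m + 3" "i \<noteq> m + 1" using i by auto
      ultimately show "lookup (?w + b) i = 0" unfolding lookup_add[of ?w] w by simp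
    next
      fix i assume i: "1 \<le> i" "i < m + 3"
      consider "i < m" | "i = m" | "i = m + 1" | "i = m + 2" using i by linarith
      thus "1 \<le> lookup (?w + b) i + lookup (?w + b) (Suc i)"
      proof cases
        case 1
        thus ?thesis using is_cover_edge[OF b i(1)] by (simp add: lookup_add)
      qed (simp_all add: lookup_add lookup_var)
    qed
  next
    fix c assume c: "is_cover (m + 3) 1 c" "c \<preceq> ?w + v"
    have le: "lookup c k \<le> (if k = m + 3 \<or> k = m + 1 then 1 else 0) + lookup v k" for k
      using c(2) unfolding divides_def lookup_add[of ?w] w by blast
    \<comment> \<open>Since the entry at \<open>m + 2\<close> vanishes, its two edges force both
      neighbours.\<close>
    have "lookup c (m + 2) = 0" using le[of "m + 2"] v0 by simp
    moreover have "lookup c (m + 1) \<le> 1" "lookup c (m + 3) \<le> 1"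
      using le[of "m + 1"] le[of "m + 3"] v0 by simp_all
    moreover have "1 \<le> lookup c (m + 2) + lookup c (m + 3)" "1 \<le> lookup c (m + 1) + lookup c (m + 2)"
      using is_cover_edge[OF c(1), of "m + 2"] is_cover_edge[OF c(1), of "m + 1"]
      by (simp_all add: numeral_3_eq_3)
    ultimately have one: "lookup c (m + 1) = 1" "lookup c (m + 3) = 1" by linarith+
    let ?b = "c - ?w"
    have b: "lookup ?b k = (if k = m + 3 \<or> k = m + 1 then 0 else lookup c k)" for k
      using one unfolding lookup_minus w by auto
    have "?w \<preceq> c" unfolding divides_def w using one by auto
    hence "c = ?w + ?b" by (rule divides_diff_eq[symmetric])
    moreover have "is_cover m 1 ?b"
    proof (rule is_coverI)
      fix i assume i: "\<not> (1 \<le> i \<and> i \<le> m)"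
      show "lookup ?b i = 0"
      proof (cases "i = 0")
        case True
        thus ?thesis using is_cover_lookup0[OF c(1), of 0] unfolding b by simp
      next
        case False
        hence "i > m" using i by simp
        thus ?thesis using le[of i] v0[of i] unfolding b by (auto split: if_splits)
      qed
    next
      fix i assume "1 \<le> i" "i < m"
      thus "1 \<le> lookup ?b i + lookup ?b (Suc i)"
        using is_cover_edge[OF c(1), of i] unfolding b by simp
    qed
    ultimately show "\<exists>b. is_cover m 1 b \<and> c = ?w + b" by blast
  qed
  thus ?thesis using True by simp
next
  case False
  thus ?thesis using is_cover_keys min_cover_imp by blast
qed

text \<open>If a minimal cover contains \<open>m + 2\<close>, then \<open>m + 3\<close> is redundant
  and excluded by minimality; otherwise both neighbours of \<open>m + 2\<close> are forced.\<close>

lemma min_cover_step: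
  "{c. min_cover (m + 3) 1 c} = (\<lambda>u. var (m + 2) + u) ` {u. min_cover (m + 1) 1 u} \<union>
     (\<lambda>v. var (m + 3) + var (m + 1) + v) ` {v. min_cover m 1 v}"
proof (intro equalityI subsetI)
  fix c assume "c \<in> {c. min_cover (m + 3) 1 c}"
  hence c: "min_cover (m + 3) 1 c" by simp
  have cov: "is_cover (m + 3) 1 c" using c by (rule min_cover_imp)
  have out: "lookup c i = 0" if "\<not> (1 \<le> i \<and> i \<le> m + 3)" for i
    using is_cover_lookup0[OF cov that] .
  have le: "lookup c i \<le> 1" for i using min_cover_bounded[OF c] .
  have e2: "1 \<le> lookup c (m + 2) + lookup c (m + 3)" and e1: "1 \<le> lookup c (m + 1) + lookup c (m + 2)"
    using is_cover_edge[OF cov, of "m + 2"] is_cover_edge[OF cov, of "m + 1"]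
    by (simp_all add: numeral_3_eq_3)
  show "c \<in> (\<lambda>u. var (m + 2) + u) ` {u. min_cover (m + 1) 1 u} \<union>
     (\<lambda>v. var (m + 3) + var (m + 1) + v) ` {v. min_cover m 1 v}"
  proof (cases "lookup c (m + 2) = 0")
    case False
    hence one: "lookup c (m + 2) = 1" using le[of "m + 2"] by simp
    \<comment> \<open>Otherwise the only edge at \<open>m + 3\<close> would have sum 2 and could not
      be tight.\<close>
    have zero: "lookup c (m + 3) = 0"
    proof (rule ccontr)
      assume "lookup c (m + 3) \<noteq> 0"
      hence "0 < lookup c (m + 3)" by simp
      thus False
      proof (rule min_cover_tight[OF c])
        fix j assume "m + 3 = Suc j" "lookup c j + lookup c (m + 3) = 1"
        moreover from this have "j = m + 2" by simp
        ultimately show False using one \<open>0 < lookup c (m + 3)\<close> by simp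
      qed simp
    qed
    let ?u = "c - var (m + 2)"
    have eq: "c = var (m + 2) + ?u"
      using one by (intro poly_mapping_eqI) (simp add: lookup_add lookup_minus lookup_var)
    have "keys ?u \<subseteq> {1..m + 1}"
    proof
      fix i assume "i \<in> keys ?u"
      hence i: "lookup c i \<noteq> 0" "i \<noteq> m + 2"
        using one by (auto simp: in_keys_iff lookup_minus lookup_var split: if_splits)
      hence "i \<noteq> m + 3" "1 \<le> i" "i \<le> m + 3" using zero out[of i] by auto
      thus "i \<in> {1..m + 1}" using i(2) by auto
    qed
    hence "min_cover (m + 1) 1 ?u" using min_cover_add_second_last[of m ?u] c eq by simp
    thus ?thesis using eq by blast
  next
    case True
    hence one: "lookup c (m + 1) = 1" "lookup c (m + 3) = 1"
      using e1 e2 le[of "m + 1"] le[of "m + 3"] by simp_all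
    let ?w = "var (m + 3) + var (m + 1)"
    have w: "lookup ?w k = (if k = m + 3 \<or> k = m + 1 then 1 else 0)" for k
      by (simp add: lookup_add lookup_var)
    let ?v = "c - ?w"
    have v: "lookup ?v k = (if k = m + 3 \<or> k = m + 1 then 0 else lookup c k)" for k
      using one unfolding lookup_minus w by auto
    have "?w \<preceq> c" unfolding divides_def w using one by auto
    hence eq: "c = ?w + ?v" by (rule divides_diff_eq[symmetric])
    have "keys ?v \<subseteq> {1..m}"
    proof
      fix i assume "i \<in> keys ?v"
      hence i: "lookup c i \<noteq> 0" "i \<noteq> m + 3" "i \<noteq> m + 1"
        unfolding in_keys_iff v by (auto split: if_splits)
      hence "i \<noteq> m + 2" "1 \<le> i" "i \<le> m + 3" using True out[of i] by auto
      thus "i \<in> {1..m}" using i(2,3) by auto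
    qed
    hence "min_cover m 1 ?v" using min_cover_add_last[of m ?v] c eq by simp
    thus ?thesis using eq by blast
  qed
next
  fix c assume "c \<in> (\<lambda>u. var (m + 2) + u) ` {u. min_cover (m + 1) 1 u} \<union>
     (\<lambda>v. var (m + 3) + var (m + 1) + v) ` {v. min_cover m 1 v}"
  thus "c \<in> {c. min_cover (m + 3) 1 c}"
    using min_cover_add_second_last[of m] min_cover_add_last[of m] by blast
qed

lemma set_rooted_exps:
  assumes "n \<ge> 1" shows "set (rooted_exps n) = {c. min_cover n 1 c}"
  using assms
proof (induction n rule: rooted_exps.induct)
  case 2
  show ?case by (auto simp: min_cover_short)
next
  case 3
  show ?case using min_cover_two by (auto simp: numeral_2_eq_2)
next
  case 4
  \<comment> \<open>The recursion at \<open>m = 0\<close> involves the path without vertices, whose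
    only minimal cover is \<open>0\<close>; the dummy \<open>rooted_exps 0\<close> does not list it,
    so this length is treated by hand.\<close>
  have "{c. min_cover 3 1 c} = {var 2, var 3 + var 1}"
    using min_cover_step[of 0]
    by (simp add: min_cover_short numeral_3_eq_3 numeral_2_eq_2 insert_commute)
  thus ?case by (auto simp: add.commute numeral_3_eq_3 numeral_2_eq_2)
next
  case (5 m)
  have "{c. min_cover (Suc m + 3) 1 c} =
      (\<lambda>u. var (m + 3) + u) ` {u. min_cover (Suc (Suc m)) 1 u} \<union>
      (\<lambda>v. var (m + 4) + var (m + 2) + v) ` {v. min_cover (Suc m) 1 v}"
    using min_cover_step[of "Suc m"] by (simp add: numeral_eq_Suc)
  thus ?case using "5.IH" by (simp add: numeral_eq_Suc)
qed simp

section \<open>The order of the rooted list\<close>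

lemma top_lt_add_cancel: "w + a \<prec> w + b \<longleftrightarrow> a \<prec> b"
  by (simp add: top_lt_def lookup_add)

text \<open>The first block avoids the last vertex and the second contains it; inside a block the
  common summand cancels.\<close>

lemma rooted_exps_sorted: "sorted_wrt (\<prec>) (rooted_exps n)"
proof (induction n rule: rooted_exps.induct)
  case 3
  show ?case by (auto simp: top_lt_def lookup_var intro!: exI[of _ 2])
next
  case 4
  show ?case by (auto simp: top_lt_def lookup_var lookup_add intro!: exI[of _ 3])
next
  case (5 m)
  have "var (m + 3) + u \<prec> var (m + 4) + var (m + 2) + v"
    if u: "u \<in> set (rooted_exps (Suc (Suc m)))" and v: "v \<in> set (rooted_exps (Suc m))" for u v
  proof -
    have cu: "is_cover (Suc (Suc m)) 1 u" and cv: "is_cover (Suc m) 1 v"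
      using u v set_rooted_exps[of "Suc (Suc m)"] set_rooted_exps[of "Suc m"] min_cover_imp by auto
    have "lookup u k = 0" "lookup v k = 0" if "k \<ge> m + 4" for k
      using is_cover_lookup0[OF cu, of k] is_cover_lookup0[OF cv, of k] that by auto
    thus ?thesis unfolding top_lt_def
      by (intro exI[of _ "m + 4"]) (simp add: lookup_add lookup_var)
  qed
  thus ?case using "5.IH" by (auto simp: sorted_wrt_append sorted_wrt_map top_lt_add_cancel)
qed simp_all

lemma rooted_exps_top_lt_nth:
  assumes "k < length (rooted_exps n)" "l < length (rooted_exps n)"
  shows "rooted_exps n ! k \<prec> rooted_exps n ! l \<longleftrightarrow> k < l"
proof -
  have "rooted_exps n ! i \<prec> rooted_exps n ! j" if "i < j" "j < length (rooted_exps n)" for i j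
    using sorted_wrt_nth_less[OF rooted_exps_sorted that] .
  thus ?thesis using assms top_lt_irrefl top_lt_trans by (metis linorder_neqE_nat)
qed

section \<open>Maximal expressions\<close>

lemma expressions_peel:
  fixes us :: "'k::field mpol list"
  assumes e: "\<alpha> \<in> expressions us (Suc s) M" and k: "k < length us" "\<alpha> ! k > 0"
  shows "\<exists>N. M = us ! k * N \<and> \<alpha>[k := \<alpha> ! k - 1] \<in> expressions us s N"
proof -
  let ?\<beta> = "\<alpha>[k := \<alpha> ! k - 1]" and ?R = "\<Prod>i\<in>{..<length us} - {k}. (us ! i) ^ (\<alpha> ! i)"
  have len: "length \<alpha> = length us" and sum: "sum_list \<alpha> = Suc s"
    and M: "M = (\<Prod>i<length us. (us ! i) ^ (\<alpha> ! i))"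
    using e by (auto simp: expressions_def)
  have "(\<Prod>i\<in>{..<length us} - {k}. (us ! i) ^ (?\<beta> ! i)) = ?R"
    by (rule prod.cong) auto
  hence "(\<Prod>i<length us. (us ! i) ^ (?\<beta> ! i)) = (us ! k) ^ (\<alpha> ! k - 1) * ?R"
    using k(1) len by (subst prod.remove[of _ k]) auto
  moreover have "M = us ! k ^ (\<alpha> ! k) * ?R"
    using M k(1) by (simp add: prod.remove[of "{..<length us}" k])
  moreover have "us ! k ^ (\<alpha> ! k) = us ! k * us ! k ^ (\<alpha> ! k - 1)"
    using k(2) by (simp add: power_eq_if)
  ultimately have "M = us ! k * (\<Prod>i<length us. (us ! i) ^ (?\<beta> ! i))"
    by (simp add: mult.assoc)
  moreover have "sum_list ?\<beta> = s"
    using k len sum elem_le_sum_list[of k \<alpha>] by (simp add: sum_list_update)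
  ultimately show ?thesis using len by (auto simp: expressions_def)
qed

lemma expressions_unpeel:
  fixes us :: "'k::field mpol list"
  assumes e: "\<alpha> \<in> expressions us s M" and k: "k < length us"
  shows "\<alpha>[k := Suc (\<alpha> ! k)] \<in> expressions us (Suc s) (us ! k * M)"
proof -
  let ?\<beta> = "\<alpha>[k := Suc (\<alpha> ! k)]" and ?R = "\<Prod>i\<in>{..<length us} - {k}. (us ! i) ^ (\<alpha> ! i)"
  have len: "length \<alpha> = length us" and sum: "sum_list \<alpha> = s"
    and M: "M = (\<Prod>i<length us. (us ! i) ^ (\<alpha> ! i))"
    using e by (auto simp: expressions_def)
  have "(\<Prod>i\<in>{..<length us} - {k}. (us ! i) ^ (?\<beta> ! i)) = ?R"
    by (rule prod.cong) auto
  hence "(\<Prod>i<length us. (us ! i) ^ (?\<beta> ! i)) = (us ! k) ^ Suc (\<alpha> ! k) * ?R"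
    using k len by (subst prod.remove[of _ k]) auto
  moreover have "M = us ! k ^ (\<alpha> ! k) * ?R"
    using M k by (simp add: prod.remove[of "{..<length us}" k])
  ultimately have "us ! k * M = (\<Prod>i<length us. (us ! i) ^ (?\<beta> ! i))"
    by (simp add: mult.assoc)
  moreover have "sum_list ?\<beta> = Suc s"
    using k len sum elem_le_sum_list[of k \<alpha>] by (simp add: sum_list_update)
  ultimately show ?thesis using len by (simp add: expressions_def)
qed

lemma expressions_0: 
  "expressions us 0 (M :: 'k::field mpol) = (if M = 1 then {replicate (length us) 0} else {})"
proof -
  have "a \<in> expressions us 0 M \<longleftrightarrow> M = 1 \<and> a = replicate (length us) 0" for a
  proof -
    have "length a = length us \<and> sum_list a = 0 \<longleftrightarrow> a = replicate (length us) 0"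
      by (auto simp: sum_list_eq_0_iff intro: replicate_eqI)
    thus ?thesis by (auto simp: expressions_def)
  qed
  thus ?thesis by auto
qed

lemma expressions_SucE:
  assumes "\<alpha> \<in> expressions us (Suc s) M"
  obtains k where "k < length us" "\<alpha> ! k > 0"
proof -
  have "sum_list \<alpha> \<noteq> 0" and len: "length \<alpha> = length us"
    using assms by (auto simp: expressions_def)
  then obtain x where "x \<in> set \<alpha>" "x > 0" by (auto simp: sum_list_eq_0_iff)
  thus ?thesis using that len by (auto simp: in_set_conv_nth)
qed

text \<open>Every generator is squarefree, which bounds each exponent by the number of factors. That
  products are monomials is recorded too, so that cofactors can be compared by exponents.\<close>

lemma expressions_rooted_bounded:
  fixes M :: "'k::field mpol"
  assumes "\<alpha> \<in> expressions (rooted_list n) s M" "n \<ge> 1"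
  shows "\<exists>a. M = monomial a \<and> (\<forall>i. lookup a i \<le> s)"
  using assms
proof (induction s arbitrary: \<alpha> M)
  case 0
  hence "M = monomial 0" by (simp add: expressions_0 monomial_0 split: if_splits)
  thus ?case by auto
next
  case (Suc s)
  obtain k where k: "k < length (rooted_list n :: 'k mpol list)" "\<alpha> ! k > 0"
    using Suc.prems(1) by (rule expressions_SucE)
  obtain N :: "'k mpol" where N: "M = rooted_list n ! k * N"
    "\<alpha>[k := \<alpha> ! k - 1] \<in> expressions (rooted_list n) s N"
    using expressions_peel[OF Suc.prems(1) k] by blast
  obtain a where a: "N = monomial a" "\<forall>i. lookup a i \<le> s" using Suc.IH[OF N(2) Suc.prems(2)] by blast
  have k': "k < length (rooted_exps n)" using k(1) by (simp add: rooted_list_eq)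
  have "min_cover n 1 (rooted_exps n ! k)"
    using nth_mem[OF k'] set_rooted_exps[OF Suc.prems(2)] by blast
  hence "lookup (rooted_exps n ! k) i \<le> 1" for i by (rule min_cover_bounded)
  hence "lookup (rooted_exps n ! k + a) i \<le> Suc s" for i
    using a(2) by (simp add: lookup_add) (metis One_nat_def add_mono plus_1_eq_Suc)
  moreover have "M = monomial (rooted_exps n ! k + a)"
    using N(1) a(1) k' by (simp add: rooted_list_eq monomial_add)
  ultimately show ?case by blast
qed

lemma expressions_rooted_peel:
  assumes e: "\<alpha> \<in> expressions (rooted_list n) (Suc s) (monomial a :: 'k::field mpol)"
    and n: "n \<ge> 1" and k: "k < length (rooted_exps n)" "\<alpha> ! k > 0"
  obtains b where "a = rooted_exps n ! k + b" "\<forall>i. lookup b i \<le> s"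
    "\<alpha>[k := \<alpha> ! k - 1] \<in> expressions (rooted_list n) s (monomial b :: 'k mpol)"
proof -
  have "k < length (rooted_list n :: 'k mpol list)" using k(1) by (simp add: rooted_list_eq)
  then obtain N :: "'k mpol" where N: "monomial a = rooted_list n ! k * N"
    "\<alpha>[k := \<alpha> ! k - 1] \<in> expressions (rooted_list n) s N"
    using expressions_peel[OF e _ k(2)] by blast
  obtain b where b: "N = monomial b" "\<forall>i. lookup b i \<le> s"
    using expressions_rooted_bounded[OF N(2) n] by blast
  have "(monomial a :: 'k mpol) = monomial (rooted_exps n ! k + b)"
    using N(1) b(1) k(1) by (simp add: rooted_list_eq monomial_add)
  hence "a = rooted_exps n ! k + b" by simp
  thus ?thesis using that b N(2) by blast
qed

lemma row_in_rooted_exps: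
  assumes "min_cover n (Suc s) a" "n \<ge> 1"
  obtains k where "k < length (rooted_exps n)" "rooted_exps n ! k = row n (Suc s) a"
proof -
  have "row n (Suc s) a \<in> set (rooted_exps n)"
    using min_cover_row(1)[OF assms(1)] set_rooted_exps[OF assms(2)] by simp
  thus ?thesis using that by (auto simp: in_set_conv_nth)
qed

text \<open>A generator that avoids a vertex \<open>i\<close> can only occur in an \<open>Suc s\<close>-fold product whose
  exponent at \<open>i\<close> is at most \<open>s\<close>; hence no generator before the greedy row occurs.\<close>

lemma expressions_row_first:
  assumes e: "\<alpha> \<in> expressions (rooted_list n) (Suc s) (monomial a :: 'k::field mpol)"
    and n: "n \<ge> 1" and l: "l < length (rooted_exps n)" "\<alpha> ! l > 0"
  shows "\<not> rooted_exps n ! l \<prec> row n (Suc s) a"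
proof
  let ?U = "rooted_exps n ! l" and ?C = "row n (Suc s) a"
  assume "?U \<prec> ?C"
  then obtain i where i: "lookup ?U i < lookup ?C i" "\<forall>k>i. lookup ?U k = lookup ?C k"
    by (auto simp: top_lt_def)
  obtain b where b: "a = ?U + b" "\<forall>i. lookup b i \<le> s" using expressions_rooted_peel[OF e n l] by metis
  have U: "is_cover n 1 ?U"
    using nth_mem[OF l(1)] set_rooted_exps[OF n] min_cover_imp by blast
  have row: "1 \<le> i" "in_row n (Suc s) a i" "lookup ?U i = 0"
    using i(1) by (auto simp: lookup_row split: if_splits)
  \<comment> \<open>The factor \<open>?U\<close> contributes nothing at \<open>i\<close>, and the
    other \<open>s\<close> factors at most one each. So \<open>i\<close> is in the row only because
    \<open>Suc i\<close> is not, and \<open>?U\<close> misses both ends of that edge.\<close>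
  hence "lookup a i < Suc s" using b by (simp add: lookup_add less_Suc_eq_le)
  hence "i < n" "\<not> in_row n (Suc s) a (Suc i)"
    using row(2) in_row.simps[of n "Suc s" a i] by (auto split: if_splits)
  hence "lookup ?U (Suc i) = 0" using i(2) by (simp add: lookup_row)
  thus False using is_cover_edge[OF U row(1) \<open>i < n\<close>] row(3) by simp
qed

section \<open>Lexicographic comparison of exponent tuples\<close>

lemma lex_gt_trans:
  assumes "length \<alpha> = length \<beta>" "lex_gt \<alpha> \<beta>" "lex_gt \<beta> \<gamma>" shows "lex_gt \<alpha> \<gamma>"
proof -
  obtain k l where k: "k < length \<alpha>" "\<forall>i<k. \<alpha> ! i = \<beta> ! i" "\<alpha> ! k > \<beta> ! k"
    and l: "l < length \<beta>" "\<forall>i<l. \<beta> ! i = \<gamma> ! i" "\<beta> ! l > \<gamma> ! l"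
    using assms by (auto simp: lex_gt_def)
  have "\<alpha> ! min k l > \<gamma> ! min k l"
    using k l by (cases k l rule: linorder_cases) auto
  thus ?thesis unfolding lex_gt_def using k l assms(1) by (intro exI[of _ "min k l"]) auto
qed

lemma lex_gt_antisym:
  assumes "length \<alpha> = length \<beta>" "lex_gt \<alpha> \<beta>" shows "\<not> lex_gt \<beta> \<alpha>"
  using lex_gt_trans[OF assms(1,2), of \<alpha>] by (auto simp: lex_gt_def)

lemma lex_gt_increment:
  assumes "lex_gt \<alpha> \<beta>" "length \<alpha> = length \<beta>" "k < length \<alpha>"
  shows "lex_gt (\<alpha>[k := Suc (\<alpha> ! k)]) (\<beta>[k := Suc (\<beta> ! k)])"
proof -
  obtain l where l: "l < length \<alpha>" "\<forall>i<l. \<alpha> ! i = \<beta> ! i" "\<alpha> ! l > \<beta> ! l"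
    using assms(1) by (auto simp: lex_gt_def)
  thus ?thesis unfolding lex_gt_def using assms(2,3)
    by (intro exI[of _ l]) (auto simp: nth_list_update)
qed

lemma max_expression_unique:
  assumes "is_max_expression us s M \<alpha>" "is_max_expression us s M \<beta>" shows "\<alpha> = \<beta>"
proof (rule ccontr)
  assume "\<alpha> \<noteq> \<beta>"
  hence "lex_gt \<alpha> \<beta>" "lex_gt \<beta> \<alpha>" "length \<alpha> = length \<beta>"
    using assms by (auto simp: is_max_expression_def expressions_def)
  thus False using lex_gt_antisym by blast
qed

text \<open>No generator before \<open>C\<close> occurs in any expression of \<open>a\<close>, and
  some expression contains \<open>C\<close>, so the maximal one does. Removing one copy of
  \<open>C\<close> matches the expressions of \<open>a\<close> containing \<open>C\<close> with
  those of \<open>a - C\<close>, compatibly with the lexicographic order.\<close>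

lemma max_expression_step:
  fixes n s :: nat and a :: "nat \<Rightarrow>\<^sub>0 nat"
  defines "C \<equiv> row n (Suc s) a"
  assumes a: "min_cover n (Suc s) a" and n: "n \<ge> 1"
    and k: "k < length (rooted_exps n)" "rooted_exps n ! k = C"
    and max: "is_max_expression (rooted_list n) s (monomial (a - C) :: 'k::field mpol) \<alpha>"
  shows "is_max_expression (rooted_list n) (Suc s) (monomial a :: 'k mpol) (\<alpha>[k := Suc (\<alpha> ! k)])"
    and "\<forall>l<k. \<alpha> ! l = 0"
proof -
  let ?us = "rooted_list n :: 'k mpol list" and ?\<alpha> = "\<alpha>[k := Suc (\<alpha> ! k)]"
  have len: "length ?us = length (rooted_exps n)" by (simp add: rooted_list_eq)
  have \<alpha>: "\<alpha> \<in> expressions ?us s (monomial (a - C))" using max by (simp add: is_max_expression_def)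
  have len\<alpha>: "length \<alpha> = length (rooted_exps n)" using \<alpha> len by (simp add: expressions_def)
  have Ca: "C + (a - C) = a"
    unfolding C_def by (rule divides_diff_eq[OF row_divides[OF min_cover_imp[OF a]]]) simp
  have "monomial a = ?us ! k * monomial (a - C)"
    using k Ca by (simp add: rooted_list_eq monomial_add[symmetric])
  hence e: "?\<alpha> \<in> expressions ?us (Suc s) (monomial a)"
    using expressions_unpeel[OF \<alpha>] k(1) len by simp
  have zero: "\<beta> ! l = 0" if \<beta>: "\<beta> \<in> expressions ?us (Suc s) (monomial a)" and l: "l < k" for \<beta> l
  proof (rule ccontr)
    have l': "l < length (rooted_exps n)" using l k(1) by simp
    assume "\<beta> ! l \<noteq> 0"
    hence "\<not> rooted_exps n ! l \<prec> C"
      unfolding C_def using expressions_row_first[OF \<beta> n l'] by simp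
    thus False using rooted_exps_top_lt_nth[OF l' k(1)] l k(2) by simp
  qed
  show "\<forall>l<k. \<alpha> ! l = 0" using zero[OF e] by simp
  have "lex_gt ?\<alpha> \<beta>" if \<beta>: "\<beta> \<in> expressions ?us (Suc s) (monomial a)" "\<beta> \<noteq> ?\<alpha>" for \<beta>
  \<comment> \<open>Both tuples vanish before \<open>k\<close>. Without \<open>C\<close> the tuple
    \<open>\<beta>\<close> loses at \<open>k\<close>; otherwise one copy of \<open>C\<close> is
    removed from it and the maximality of \<open>\<alpha>\<close> applies.\<close>
  proof (cases "\<beta> ! k = 0")
    case True
    thus ?thesis unfolding lex_gt_def
      using zero[OF e] zero[OF \<beta>(1)] k(1) len\<alpha> by (intro exI[of _ k]) simp
  next
    case False
    let ?\<gamma> = "\<beta>[k := \<beta> ! k - 1]"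
    have len\<beta>: "length \<beta> = length (rooted_exps n)" using \<beta>(1) len by (simp add: expressions_def)
    obtain b where b: "a = rooted_exps n ! k + b"
        "?\<gamma> \<in> expressions ?us s (monomial b)"
      using expressions_rooted_peel[OF \<beta>(1) n k(1)] False by (metis neq0_conv)
    have "b = a - C" using b(1) k(2) by simp
    hence \<gamma>: "?\<gamma> \<in> expressions ?us s (monomial (a - C))" using b(2) by simp
    have restore: "?\<gamma>[k := Suc (?\<gamma> ! k)] = \<beta>" using False k(1) len\<beta> by simp
    hence "?\<gamma> \<noteq> \<alpha>" using \<beta>(2) by metis
    hence "lex_gt \<alpha> ?\<gamma>" using max \<gamma> unfolding is_max_expression_def by blast
    hence "lex_gt ?\<alpha> (?\<gamma>[k := Suc (?\<gamma> ! k)])"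
      by (rule lex_gt_increment) (use len\<alpha> len\<beta> k(1) in auto)
    thus ?thesis using restore by simp
  qed
  thus "is_max_expression ?us (Suc s) (monomial a) ?\<alpha>" using e by (simp add: is_max_expression_def)
qed

lemma ex_max_expression:
  assumes "min_cover n s a" "n \<ge> 1"
  shows "\<exists>\<alpha>. is_max_expression (rooted_list n) s (monomial a :: 'k::field mpol) \<alpha>"
  using assms
proof (induction s arbitrary: a)
  case 0
  have "a = 0" using min_cover_bounded[OF 0(1)] by (intro poly_mapping_eqI) simp
  thus ?case by (auto simp: is_max_expression_def expressions_0 monomial_0)
next
  case (Suc s)
  obtain k where k: "k < length (rooted_exps n)" "rooted_exps n ! k = row n (Suc s) a"
    using row_in_rooted_exps[OF Suc.prems] by blast
  obtain \<alpha> where "is_max_expression (rooted_list n) s (monomial (a - row n (Suc s) a) :: 'k mpol) \<alpha>"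
    using Suc.IH[OF min_cover_row(2)[OF Suc.prems(1)] Suc.prems(2)] by blast
  thus ?case using max_expression_step(1)[OF Suc.prems k] by blast
qed

text \<open>Equal first rows increment the same position of the tuples of the remainders. Otherwise
  the row of \<open>a\<close> has the earlier position, where \<open>\<alpha>\<close> is positive
  and \<open>\<beta>\<close> vanishes.\<close>

lemma greedy_gt_imp_lex_gt:
  assumes "greedy_gt n s a b" "min_cover n s a" "min_cover n s b" "n \<ge> 1"
    "is_max_expression (rooted_list n) s (monomial a :: 'k::field mpol) \<alpha>"
    "is_max_expression (rooted_list n) s (monomial b :: 'k::field mpol) \<beta>"
  shows "lex_gt \<alpha> \<beta>"
  using assms
proof (induction s arbitrary: a b \<alpha> \<beta>)
  case (Suc s)
  let ?C = "row n (Suc s) a" and ?D = "row n (Suc s) b"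
  obtain k l where k: "k < length (rooted_exps n)" "rooted_exps n ! k = ?C"
    and l: "l < length (rooted_exps n)" "rooted_exps n ! l = ?D"
    using row_in_rooted_exps[OF Suc.prems(2,4)] row_in_rooted_exps[OF Suc.prems(3,4)] by metis
  have a': "min_cover n s (a - ?C)" and b': "min_cover n s (b - ?D)"
    using min_cover_row(2) Suc.prems(2,3) by blast+
  obtain \<alpha>' \<beta>' where max: "is_max_expression (rooted_list n) s (monomial (a - ?C) :: 'k mpol) \<alpha>'"
    "is_max_expression (rooted_list n) s (monomial (b - ?D) :: 'k mpol) \<beta>'"
    using ex_max_expression[OF a' Suc.prems(4)] ex_max_expression[OF b' Suc.prems(4)] by blast
  note sa = max_expression_step[OF Suc.prems(2,4) k max(1)]
  note sb = max_expression_step[OF Suc.prems(3,4) l max(2)]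
  have \<alpha>: "\<alpha> = \<alpha>'[k := Suc (\<alpha>' ! k)]" and \<beta>: "\<beta> = \<beta>'[l := Suc (\<beta>' ! l)]"
    using max_expression_unique sa(1) sb(1) Suc.prems(5,6) by blast+
  have len: "length \<alpha>' = length (rooted_exps n)" "length \<beta>' = length (rooted_exps n)"
    using max by (simp_all add: is_max_expression_def expressions_def rooted_list_eq)
  show ?case
  proof (cases "?C = ?D")
    case True
    hence "k = l" using k l rooted_exps_top_lt_nth top_lt_irrefl by (metis linorder_neqE_nat)
    moreover have "greedy_gt n s (a - ?C) (b - ?D)"
      using Suc.prems(1) True top_lt_irrefl by simp
    hence "lex_gt \<alpha>' \<beta>'" using Suc.IH[OF _ a' b' Suc.prems(4) max] by blast
    ultimately show ?thesis using lex_gt_increment len k(1) \<alpha> \<beta> by simp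
  next
    case False
    hence "k < l" using Suc.prems(1) k l rooted_exps_top_lt_nth[OF k(1) l(1)] by simp
    thus ?thesis unfolding lex_gt_def \<alpha> \<beta> using sa(2) sb(2) k(1) len
      by (intro exI[of _ k]) simp
  qed
qed simp

text \<open>The converse holds because the greedy comparison is total on minimal covers and the
  lexicographic one is asymmetric.\<close>

lemma rooted_gt_iff_greedy_gt:
  assumes "min_cover n s a" "min_cover n s b" "n \<ge> 1"
  shows "rooted_gt (rooted_list n) s (monomial a :: 'k::field mpol) (monomial b) \<longleftrightarrow> greedy_gt n s a b"
proof
  obtain \<alpha> \<beta> where max: "is_max_expression (rooted_list n) s (monomial a :: 'k mpol) \<alpha>"
    "is_max_expression (rooted_list n) s (monomial b :: 'k mpol) \<beta>"
    using ex_max_expression assms by blast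
  show "rooted_gt (rooted_list n) s (monomial a :: 'k mpol) (monomial b)" if "greedy_gt n s a b"
    using greedy_gt_imp_lex_gt[OF that assms max] max by (auto simp: rooted_gt_def)
  assume "rooted_gt (rooted_list n) s (monomial a :: 'k mpol) (monomial b)"
  hence gt: "lex_gt \<alpha> \<beta>" using max max_expression_unique unfolding rooted_gt_def by blast
  have len: "length \<alpha> = length \<beta>"
    using max by (simp add: is_max_expression_def expressions_def)
  hence asym: "\<not> lex_gt \<beta> \<alpha>" using gt lex_gt_antisym by blast
  hence "a \<noteq> b" using gt max max_expression_unique by blast
  moreover have "\<not> greedy_gt n s b a"
    using greedy_gt_imp_lex_gt[OF _ assms(2,1,3) max(2,1)] asym by blast
  ultimately show "greedy_gt n s a b" using greedy_gt_total[OF assms(1,2)] by blast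
qed

section \<open>Monomial ideals\<close>

text \<open>\<open>U\<close> may contain any exponent vectors; the carrier restricts them to the
  variables of the ring. An ideal arises when \<open>U\<close> is upward closed.\<close>

definition mon_span :: "nat \<Rightarrow> (nat \<Rightarrow>\<^sub>0 nat) set \<Rightarrow> 'k::field mpol set" where
  "mon_span n U = {p \<in> carrier (poly_ring n). keys p \<subseteq> U}"

lemma ideal_mon_span:
  assumes up: "\<And>m m'. m \<in> U \<Longrightarrow> m \<preceq> m' \<Longrightarrow> m' \<in> U"
  shows "ideal (mon_span n U :: 'k::field mpol set) (poly_ring n)"
proof -
  interpret R: cring "poly_ring n :: 'k mpol ring" by (rule cring_poly_ring)
  let ?D = "mon_span n U :: 'k mpol set"
  have mult: "x * p \<in> ?D" if p: "p \<in> ?D" and x: "x \<in> carrier (poly_ring n)" for p x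
  proof -
    have "k \<in> U" if k: "k \<in> keys (x * p)" for k
    proof -
      from k Poly_Mapping.keys_mult[of x p] obtain c d where "k = d + c" "d \<in> keys p"
        by (auto simp: add.commute)
      thus ?thesis using p up[of d k] by (auto simp: mon_span_def divides_iff_add)
    qed
    thus ?thesis using p x by (auto simp: mon_span_def poly_ring_mult)
  qed
  have "subgroup ?D (add_monoid (poly_ring n))"
  proof (rule group.subgroupI[OF R.a_group])
    show "?D \<noteq> {}" by (auto simp: mon_span_def mem_poly_ring intro!: exI[of _ 0])
    fix p assume p: "p \<in> ?D"
    hence "\<ominus>\<^bsub>poly_ring n\<^esub> p = - p"
      using R.minus_equality[of "- p" p] by (simp add: mon_span_def mem_poly_ring)
    moreover have "- p \<in> ?D" using p by (simp add: mon_span_def mem_poly_ring)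
    ultimately show "inv\<^bsub>add_monoid (poly_ring n)\<^esub> p \<in> ?D" by (simp add: a_inv_def)
    fix q assume "q \<in> ?D"
    hence "p + q \<in> ?D"
      using p Poly_Mapping.keys_add[of p q] by (auto simp: mon_span_def poly_ring_add)
    thus "p \<otimes>\<^bsub>add_monoid (poly_ring n)\<^esub> q \<in> ?D" by simp
  qed (auto simp: mon_span_def)
  thus ?thesis using mult R.ring_axioms by (intro idealI) (simp_all add: mult.commute)
qed

text \<open>A polynomial with support in \<open>U\<close> is a finite sum of terms, each a constant
  times a monomial of the ideal.\<close>

lemma ideal_eq_mon_span:
  fixes I :: "'k::field mpol set"
  assumes I: "ideal I (poly_ring n)" and sub: "\<And>p. p \<in> I \<Longrightarrow> keys p \<subseteq> U"
    and mon: "\<And>m. m \<in> U \<Longrightarrow> keys m \<subseteq> {1..n} \<Longrightarrow> monomial m \<in> I"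
  shows "I = mon_span n U"
proof
  interpret I: ideal I "poly_ring n :: 'k mpol ring" by (rule I)
  note I_zero = additive_subgroup.zero_closed[OF ideal.axioms(1)[OF I]]
    and I_add = additive_subgroup.a_closed[OF ideal.axioms(1)[OF I]]
  show "I \<subseteq> mon_span n U" using sub I.Icarr by (auto simp: mon_span_def)
  have term_in: "Poly_Mapping.single m c \<in> I" if "m \<in> U" "keys m \<subseteq> {1..n}" for m c
  proof -
    have "Poly_Mapping.single 0 c \<in> carrier (poly_ring n)" by (auto simp: mem_poly_ring split: if_splits)
    hence "Poly_Mapping.single 0 c * monomial m \<in> I"
      using I.I_l_closed[OF mon[OF that]] by simp
    thus ?thesis by (simp add: monomial_def mult_single)
  qed
  \<comment> \<open>Induction over a finite set \<open>K\<close> containing the support: subtracting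
    the term at \<open>m\<close> leads to the smaller set even if its coefficient is 0.\<close>
  have "p \<in> I" if "finite K" "keys p \<subseteq> K" "K \<subseteq> U" "\<forall>m\<in>K. keys m \<subseteq> {1..n}" for K p
    using that
  proof (induction K arbitrary: p)
    case empty
    thus ?case using I_zero by simp
  next
    case (insert m K)
    let ?t = "Poly_Mapping.single m (lookup p m)"
    have "keys (p - ?t) \<subseteq> K"
      using insert.prems(1) by (auto simp: in_keys_iff lookup_minus lookup_single when_def split: if_splits)
    hence "p - ?t \<in> I" using insert by simp
    moreover have "?t \<in> I" using insert.prems by (intro term_in) auto
    ultimately have "(p - ?t) + ?t \<in> I" using I_add by fastforce
    thus ?case by simp
  qed
  from this[OF finite_keys subset_refl] show "mon_span n U \<subseteq> I"
    unfolding mon_span_def mem_poly_ring by blast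
qed

lemma genideal_monomials:
  fixes A :: "'k::field mpol set"
  assumes A: "A \<subseteq> monomials n"
  shows "Idl\<^bsub>poly_ring n\<^esub> A = mon_span n {m. \<exists>a. monomial a \<in> A \<and> a \<preceq> m}"
proof (rule ideal_eq_mon_span)
  interpret R: cring "poly_ring n :: 'k mpol ring" by (rule cring_poly_ring)
  let ?U = "{m. \<exists>a. monomial a \<in> A \<and> a \<preceq> m}"
  have Ac: "A \<subseteq> carrier (poly_ring n)" using A monomials_carrier by blast
  show "ideal (Idl\<^bsub>poly_ring n\<^esub> A) (poly_ring n)" by (rule R.genideal_ideal[OF Ac])
  have "A \<subseteq> mon_span n ?U"
    using A Ac divides_refl by (fastforce simp: mon_span_def monomials_def)
  moreover have "ideal (mon_span n ?U :: 'k mpol set) (poly_ring n)"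
    by (rule ideal_mon_span) (use divides_trans in blast)
  ultimately have "Idl\<^bsub>poly_ring n\<^esub> A \<subseteq> mon_span n ?U"
    using R.genideal_minimal by blast
  thus "keys p \<subseteq> ?U" if "p \<in> Idl\<^bsub>poly_ring n\<^esub> A" for p using that by (auto simp: mon_span_def)
  show "monomial m \<in> Idl\<^bsub>poly_ring n\<^esub> A" if "m \<in> ?U" "keys m \<subseteq> {1..n}" for m
    using that mon_in_Idl_iff[OF A that(2)] by (auto simp: divides_iff_add)
qed

lemma var_divides_iff: "var i \<preceq> m \<longleftrightarrow> lookup m i > 0"
  by (auto simp: divides_def lookup_var split: if_splits)

lemma genideal_variables:
  assumes "V \<subseteq> {1..n}"
  shows "Idl\<^bsub>poly_ring n\<^esub> (X ` V) = (mon_span n {m. \<exists>i\<in>V. lookup m i > 0} :: 'k::field mpol set)"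
proof -
  have "(X ` V :: 'k mpol set) \<subseteq> monomials n"
    using assms by (auto simp: X_eq_monomial var_def)
  moreover have "(\<exists>a. (monomial a :: 'k mpol) \<in> X ` V \<and> a \<preceq> m) \<longleftrightarrow> (\<exists>i\<in>V. lookup m i > 0)" for m
    by (auto simp: X_eq_monomial image_iff var_divides_iff)
  ultimately show ?thesis by (simp add: genideal_monomials)
qed

text \<open>Multiplication by a monomial translates exponents injectively, so no terms
  cancel.\<close>

lemma mem_mult_monomial_keys:
  fixes f :: "'k::field mpol"
  assumes "k \<in> keys f" shows "k + a \<in> keys (f * monomial a)"
proof -
  define q where "q = f - Poly_Mapping.single k (lookup f k)"
  have f: "f = q + Poly_Mapping.single k (lookup f k)" by (simp add: q_def)
  have q: "k \<notin> keys q" by (simp add: q_def in_keys_iff lookup_minus)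
  have "k + a \<notin> keys (q * monomial a)"
    using Poly_Mapping.keys_mult[of q "monomial a"] q by auto
  hence "lookup (q * monomial a) (k + a) = 0" by (simp add: in_keys_iff)
  moreover have "f * monomial a = q * monomial a + Poly_Mapping.single (k + a) (lookup f k)"
    by (subst f) (simp add: distrib_right monomial_def mult_single)
  ultimately have "lookup (f * monomial a) (k + a) = lookup f k" by (simp add: lookup_add)
  thus ?thesis using assms by (simp add: in_keys_iff)
qed

text \<open>The single product with \<open>monomial a\<close> already decides membership, since its
  support is the translated support of \<open>f\<close>.\<close>

lemma ideal_colon_monomial:
  fixes a :: "nat \<Rightarrow>\<^sub>0 nat"
  assumes B: "\<forall>b\<in>B. keys b \<subseteq> {1..n}" and a: "keys a \<subseteq> {1..n}"
  shows "ideal_colon n (Idl\<^bsub>poly_ring n\<^esub> (monomial ` B)) (Idl\<^bsub>poly_ring n\<^esub> {monomial a}) =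
    (mon_span n {m. \<exists>b\<in>B. b \<preceq> m + a} :: 'k::field mpol set)"
proof -
  have IB: "Idl\<^bsub>poly_ring n\<^esub> (monomial ` B) = (mon_span n {m. \<exists>b\<in>B. b \<preceq> m} :: 'k mpol set)"
    using B by (subst genideal_monomials) (auto intro!: arg_cong[where f = "mon_span n"])
  have Ia: "Idl\<^bsub>poly_ring n\<^esub> {monomial a} = (mon_span n {m. a \<preceq> m} :: 'k mpol set)"
    using a by (subst genideal_monomials) auto
  show ?thesis
  proof (intro equalityI subsetI)
    fix f :: "'k mpol" assume "f \<in> ideal_colon n (Idl\<^bsub>poly_ring n\<^esub> (monomial ` B)) (Idl\<^bsub>poly_ring n\<^esub> {monomial a})"
    hence f: "f \<in> carrier (poly_ring n)" and "\<forall>g\<in>mon_span n {m. a \<preceq> m}. f * g \<in> mon_span n {m. \<exists>b\<in>B. b \<preceq> m}"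
      by (simp_all add: ideal_colon_def IB Ia)
    moreover have "monomial a \<in> (mon_span n {m. a \<preceq> m} :: 'k mpol set)"
      using a by (simp add: mon_span_def mem_poly_ring divides_refl)
    ultimately have "keys (f * monomial a) \<subseteq> {m. \<exists>b\<in>B. b \<preceq> m}"
      by (auto simp: mon_span_def)
    thus "f \<in> mon_span n {m. \<exists>b\<in>B. b \<preceq> m + a}"
      using f mem_mult_monomial_keys[of _ f a] by (auto simp: mon_span_def)
  next
    fix f :: "'k mpol" assume f: "f \<in> mon_span n {m. \<exists>b\<in>B. b \<preceq> m + a}"
    have "f * g \<in> mon_span n {m. \<exists>b\<in>B. b \<preceq> m}" if g: "g \<in> mon_span n {m. a \<preceq> m}" for g
    proof -
      have "\<exists>b\<in>B. b \<preceq> m" if "m \<in> keys (f * g)" for m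
      proof -
        from that Poly_Mapping.keys_mult[of f g] obtain k l
          where m: "m = k + l" "k \<in> keys f" "l \<in> keys g" by blast
        obtain b where b: "b \<in> B" "b \<preceq> k + a" using f m(2) by (auto simp: mon_span_def)
        have "a \<preceq> l" using g m(3) by (auto simp: mon_span_def)
        hence "b \<preceq> m" using b(2) divides_trans unfolding m(1) by (simp add: add_divides_cancel)
        thus ?thesis using b(1) by blast
      qed
      thus ?thesis using f g by (auto simp: mon_span_def poly_ring_mult)
    qed
    thus "f \<in> ideal_colon n (Idl\<^bsub>poly_ring n\<^esub> (monomial ` B)) (Idl\<^bsub>poly_ring n\<^esub> {monomial a})"
      using f by (simp add: ideal_colon_def IB Ia mon_span_def)
  qed
qed

text \<open>The usual criterion for linear quotients: the quotient of each \<open>b\<close> by its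
  gcd with \<open>a\<close> is divisible by a variable of the colon ideal.\<close>

lemma ideal_colon_variables:
  fixes a :: "nat \<Rightarrow>\<^sub>0 nat"
  assumes B: "\<forall>b\<in>B. keys b \<subseteq> {1..n}" and a: "keys a \<subseteq> {1..n}"
    and ex: "\<And>b. b \<in> B \<Longrightarrow> \<exists>j\<in>{1..n}. lookup a j < lookup b j \<and> (\<exists>c\<in>B. c \<preceq> a + var j)"
  shows "\<exists>V\<subseteq>{1..n}. ideal_colon n (Idl\<^bsub>poly_ring n\<^esub> (monomial ` B)) (Idl\<^bsub>poly_ring n\<^esub> {monomial a}) =
    (Idl\<^bsub>poly_ring n\<^esub> (X ` V) :: 'k::field mpol set)"
proof (intro exI conjI)
  \<comment> \<open>These are the variables that lie in the colon ideal.\<close>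
  let ?V = "{j \<in> {1..n}. \<exists>c\<in>B. c \<preceq> a + var j}"
  show V: "?V \<subseteq> {1..n}" by blast
  have "(\<exists>b\<in>B. b \<preceq> m + a) \<longleftrightarrow> (\<exists>j\<in>?V. lookup m j > 0)" for m
  proof
    assume "\<exists>b\<in>B. b \<preceq> m + a"
    then obtain b where b: "b \<in> B" "b \<preceq> m + a" by blast
    obtain j where j: "j \<in> ?V" "lookup a j < lookup b j" using ex[OF b(1)] by blast
    have "lookup b j \<le> lookup m j + lookup a j" using b(2) by (simp add: divides_def lookup_add)
    thus "\<exists>j\<in>?V. lookup m j > 0" using j by (intro bexI[of _ j]) auto
  next
    assume "\<exists>j\<in>?V. lookup m j > 0"
    then obtain j c where "c \<in> B" "c \<preceq> a + var j" "var j \<preceq> m" by (auto simp: var_divides_iff)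
    moreover from this have "a + var j \<preceq> m + a"
      by (simp add: add_divides_cancel add.commute[of m])
    ultimately show "\<exists>b\<in>B. b \<preceq> m + a" using divides_trans by blast
  qed
  thus "ideal_colon n (Idl\<^bsub>poly_ring n\<^esub> (monomial ` B)) (Idl\<^bsub>poly_ring n\<^esub> {monomial a}) =
      (Idl\<^bsub>poly_ring n\<^esub> (X ` ?V) :: 'k mpol set)"
    by (simp only: ideal_colon_monomial[OF B a] genideal_variables[OF V])
qed

section \<open>Powers of the cover ideal\<close>

text \<open>Membership in an ideal generated by two variables is tested term by term, so
  intersecting over the edges collects one inequality per edge.\<close>

lemma cover_ideal_path:
  "cover_ideal n (path_edges n) = (mon_span n {m. is_cover n 1 m} :: 'k::field mpol set)"
proof -
  have edge: "Idl\<^bsub>poly_ring n\<^esub> (X ` {i, i + 1}) =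
      (mon_span n {m. 1 \<le> lookup m i + lookup m (Suc i)} :: 'k mpol set)" if "1 \<le> i" "i + 1 \<le> n" for i
    using that by (subst genideal_variables) (auto intro!: arg_cong[where f = "mon_span n"])
  have "p \<in> cover_ideal n (path_edges n) \<longleftrightarrow> p \<in> carrier (poly_ring n) \<and>
      (\<forall>i. 1 \<le> i \<and> i + 1 \<le> n \<longrightarrow> p \<in> mon_span n {m. 1 \<le> lookup m i + lookup m (Suc i)})" for p :: "'k mpol"
    unfolding cover_ideal_def path_edges_def using edge by blast
  also have "\<dots> p \<longleftrightarrow> p \<in> mon_span n {m. is_cover n 1 m}" for p :: "'k mpol"
    unfolding mon_span_def is_cover_def mem_poly_ring Suc_eq_plus1[symmetric] Suc_le_eq by blast
  finally show ?thesis by blast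
qed

text \<open>Adding covers gives one inclusion. For the other, every \<open>Suc s\<close>-cover
  splits into its greedy row and an \<open>s\<close>-cover.\<close>

lemma ideal_prod_covers:
  "ideal_prod (poly_ring n) (mon_span n {m. is_cover n s m}) (mon_span n {m. is_cover n 1 m}) =
    (mon_span n {m. is_cover n (Suc s) m} :: 'k::field mpol set)"
  (is "ideal_prod ?R ?I ?J = _")
proof (rule ideal_eq_mon_span)
  interpret R: cring "poly_ring n :: 'k mpol ring" by (rule cring_poly_ring)
  \<comment> \<open>Because of the support bound, covers need not be upward closed among all
    vectors. Passing to the upward closure changes nothing inside the ring.\<close>
  have span_Int: "mon_span n {m. is_cover n t m} =
      (mon_span n {m. \<exists>c. is_cover n t c \<and> c \<preceq> m} :: 'k mpol set)" for t
    using is_cover_mono divides_refl unfolding mon_span_def mem_poly_ring by blast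
  have ideal: "ideal (mon_span n {m. is_cover n t m} :: 'k mpol set) ?R" for t
    unfolding span_Int by (rule ideal_mon_span) (use divides_trans in blast)
  show "ideal (ideal_prod ?R ?I ?J) ?R" by (rule R.ideal_prod_is_ideal[OF ideal ideal])
  show "keys p \<subseteq> {m. is_cover n (Suc s) m}" if "p \<in> ideal_prod ?R ?I ?J" for p
    using that
  proof (induction rule: ideal_prod.induct)
    case (prod p q)
    show ?case
    proof
      fix m assume "m \<in> keys (p \<otimes>\<^bsub>?R\<^esub> q)"
      then obtain k l where "m = k + l" "k \<in> keys p" "l \<in> keys q"
        using Poly_Mapping.keys_mult[of p q] by auto
      thus "m \<in> {m. is_cover n (Suc s) m}"
        using prod is_cover_add[of n s k 1 l] by (auto simp: mon_span_def)
    qed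
  next
    case (sum p q)
    thus ?case using Poly_Mapping.keys_add[of p q] by auto
  qed
  fix m assume "m \<in> {m. is_cover n (Suc s) m}"
  hence m: "is_cover n (Suc s) m" by simp
  let ?C = "row n (Suc s) m"
  have C: "is_cover n 1 ?C" "is_cover n s (m - ?C)" using row_cover row_diff_cover[OF m] by blast+
  hence "monomial ?C \<in> ?J" "monomial (m - ?C) \<in> ?I"
    using is_cover_keys by (simp_all add: mon_span_def mem_poly_ring)
  hence "monomial (m - ?C) * monomial ?C \<in> ideal_prod ?R ?I ?J"
    using ideal_prod.prod[of "monomial (m - ?C)" ?I "monomial ?C" ?J ?R] by simp
  moreover have "(monomial (m - ?C) * monomial ?C :: 'k mpol) = monomial m"
    using divides_diff_eq[OF row_divides[OF m]] by (simp add: monomial_add[symmetric] add.commute)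
  ultimately show "monomial m \<in> ideal_prod ?R ?I ?J" by simp
qed

lemma path_cover_power_eq:
  "path_cover_power n s = (mon_span n {m. is_cover n s m} :: 'k::field mpol set)"
proof (induction s)
  case 0
  have "path_cover_power n 0 = (carrier (poly_ring n) :: 'k mpol set)"
    by (simp add: path_cover_power_def ideal_power_def nat_pow_def ideals_set_def)
  moreover have "is_cover n 0 m \<longleftrightarrow> keys m \<subseteq> {1..n}" for m by (simp add: is_cover_def)
  hence "p \<in> mon_span n {m. is_cover n 0 m} \<longleftrightarrow> p \<in> carrier (poly_ring n)" for p :: "'k mpol"
    unfolding mon_span_def mem_poly_ring by blast
  ultimately show ?case by blast
next
  case (Suc s)
  have "path_cover_power n (Suc s) =
      (ideal_prod (poly_ring n) (path_cover_power n s) (cover_ideal n (path_edges n)) :: 'k mpol set)"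
    by (simp add: path_cover_power_def ideal_power_def nat_pow_def ideals_set_def)
  thus ?case by (simp only: Suc cover_ideal_path ideal_prod_covers)
qed

text \<open>All covers together form a monomial generating set, and its members minimal under
  divisibility are the minimal generators.\<close>

lemma min_mon_gens_path_cover_power:
  "min_mon_gens n (path_cover_power n s) = (monomial ` {a. min_cover n s a} :: 'k::field mpol set)"
proof -
  let ?A = "monomial ` {a. is_cover n s a} :: 'k mpol set"
  have A: "?A \<subseteq> monomials n" using is_cover_keys by auto
  have "Idl\<^bsub>poly_ring n\<^esub> ?A = mon_span n {m. \<exists>c. is_cover n s c \<and> c \<preceq> m}"
    using A by (subst genideal_monomials) (auto intro!: arg_cong[where f = "mon_span n"])
  also have "\<dots> = path_cover_power n s"
    unfolding path_cover_power_eq using is_cover_mono divides_refl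
    unfolding mon_span_def mem_poly_ring by blast
  finally have Idl: "Idl\<^bsub>poly_ring n\<^esub> ?A = path_cover_power n s" .
  have "{monomial m | m. monomial m \<in> ?A \<and> (\<forall>a b. monomial a \<in> ?A \<and> m = a + b \<longrightarrow> a = m)} =
      (monomial ` {a. min_cover n s a} :: 'k mpol set)"
  proof -
    have "(monomial m :: 'k mpol) \<in> ?A \<longleftrightarrow> is_cover n s m" for m by auto
    thus ?thesis unfolding min_cover_def divides_iff_add by blast
  qed
  hence "is_min_mon_gens n (path_cover_power n s) (monomial ` {a. min_cover n s a} :: 'k mpol set)"
    using is_min_mon_gens_minimal[OF A] Idl by simp
  thus ?thesis
    unfolding min_mon_gens_def using ex1_min_mon_gens[OF A] Idl by (metis (no_types, lifting) the1_equality)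
qed

section \<open>The rooted order\<close>

text \<open>The heads agree: otherwise each would occur in the tail of the other list, against
  asymmetry.\<close>

lemma sorted_wrt_unique:
  assumes "irreflp P" "transp P" "sorted_wrt P xs" "sorted_wrt P ys" "set xs = set ys"
  shows "xs = ys"
  using assms(3-5)
proof (induction xs arbitrary: ys)
  case (Cons x xs)
  then obtain y zs where ys: "ys = y # zs" by (cases ys) auto
  have asym: "\<not> P b a" if "P a b" for a b
    using that assms(1,2) by (meson irreflpD transpD)
  have "x = y"
  proof (rule ccontr)
    assume "x \<noteq> y"
    hence "x \<in> set zs" "y \<in> set xs" using Cons.prems(3) ys by auto
    thus False using Cons.prems(1,2) ys asym by auto
  qed
  moreover have "x \<notin> set xs" "y \<notin> set zs"
    using Cons.prems(1,2) ys irreflpD[OF assms(1)] by auto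
  ultimately have "set xs = set zs" using Cons.prems(3) ys by auto
  thus ?case using Cons ys \<open>x = y\<close> by auto
qed simp

lemma ex_sorted_wrt:
  assumes "transp P" "finite A" "totalp_on A P"
  shows "\<exists>xs. set xs = A \<and> sorted_wrt P xs"
  using assms(2,3)
proof (induction A)
  case (insert x A)
  have tot: "P a b \<or> P b a" if "a \<in> insert x A" "b \<in> insert x A" "a \<noteq> b" for a b
    using insert.prems that by (auto simp: totalp_on_def)
  then obtain xs where xs: "set xs = A" "sorted_wrt P xs"
    using insert.IH by (auto simp: totalp_on_def)
  \<comment> \<open>By totality the two filters together retain every element of \<open>xs\<close>;
    transitivity orders them across \<open>x\<close>.\<close>
  let ?ys = "filter (\<lambda>y. P y x) xs @ x # filter (\<lambda>y. P x y) xs"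
  have "set ?ys = insert x A" using xs(1) tot insert.hyps(2) by auto
  moreover have "sorted_wrt P ?ys"
    using xs(2) transpD[OF assms(1)] by (auto simp: sorted_wrt_append sorted_wrt_filter)
  ultimately show ?case by blast
qed simp

lemma irreflp_rooted_gt: "irreflp (rooted_gt us s)"
proof (rule irreflpI)
  fix M show "\<not> rooted_gt us s M M"
  proof
    assume "rooted_gt us s M M"
    then obtain a b where "is_max_expression us s M a" "is_max_expression us s M b" and gt: "lex_gt a b"
      by (auto simp: rooted_gt_def)
    hence "a = b" using max_expression_unique by blast
    thus False using gt by (simp add: lex_gt_def)
  qed
qed

lemma transp_rooted_gt: "transp (rooted_gt us s)"
proof (rule transpI)
  fix L M N assume "rooted_gt us s L M" "rooted_gt us s M N"
  then obtain a b b' c where a: "is_max_expression us s L a" and b: "is_max_expression us s M b"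
    and ab: "lex_gt a b" and b': "is_max_expression us s M b'"
    and c: "is_max_expression us s N c" and bc: "lex_gt b' c"
    by (auto simp: rooted_gt_def)
  have "b' = b" using max_expression_unique[OF b' b] .
  moreover have "length a = length b"
    using a b by (simp add: is_max_expression_def expressions_def)
  ultimately have "lex_gt a c" using lex_gt_trans ab bc by blast
  thus "rooted_gt us s L N" using a c by (auto simp: rooted_gt_def)
qed

text \<open>Existence and uniqueness of the sorted enumeration make the description in
  \<open>rooted_power_list\<close> meaningful.\<close>

lemma rooted_power_list:
  assumes "n \<ge> 1"
  shows "set (rooted_power_list n s :: 'k::field mpol list) = monomial ` {a. min_cover n s a}"
    and "sorted_wrt (rooted_gt (rooted_list n) s) (rooted_power_list n s :: 'k mpol list)"
proof -
  let ?P = "rooted_gt (rooted_list n) s :: 'k mpol \<Rightarrow> _" and ?G = "monomial ` {a. min_cover n s a} :: 'k mpol set"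
  have "totalp_on ?G ?P"
    using greedy_gt_total rooted_gt_iff_greedy_gt[OF _ _ assms] by (fastforce simp: totalp_on_def)
  then obtain Ys where Ys: "set Ys = ?G \<and> sorted_wrt ?P Ys"
    using ex_sorted_wrt[OF transp_rooted_gt] finite_min_covers by blast
  have "rooted_power_list n s = Ys"
    unfolding rooted_power_list_def min_mon_gens_path_cover_power
  proof (rule the_equality)
    show "set Ys = ?G \<and> sorted_wrt ?P Ys" by (rule Ys)
    fix Zs assume Zs: "set Zs = ?G \<and> sorted_wrt ?P Zs"
    show "Zs = Ys"
      using sorted_wrt_unique[OF irreflp_rooted_gt transp_rooted_gt, of _ _ Zs Ys] Ys Zs by metis
  qed
  thus "set (rooted_power_list n s) = ?G" "sorted_wrt ?P (rooted_power_list n s)" using Ys by auto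
qed

section \<open>Linear quotients of the powers of the cover ideal\<close>

theorem theorem4p3:
  fixes n s :: nat
  assumes "n \<ge> 1" and "s \<ge> 1"
  shows "has_linear_quotients n (path_cover_power n s :: 'k::field mpol set) (rooted_power_list n s)"
proof -
  let ?P = "rooted_gt (rooted_list n) s :: 'k mpol \<Rightarrow> _" and ?Ys = "rooted_power_list n s :: 'k mpol list"
  have set: "set ?Ys = monomial ` {a. min_cover n s a}" and sorted: "sorted_wrt ?P ?Ys"
    using rooted_power_list[OF assms(1)] by blast+
  have lt: "?P (?Ys ! i) (?Ys ! j) \<longleftrightarrow> i < j" if "i < length ?Ys" "j < length ?Ys" for i j
  proof -
    have "?P (?Ys ! i) (?Ys ! j)" if "i < j" "j < length ?Ys" for i j
      using sorted_wrt_nth_less[OF sorted that] .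
    thus ?thesis using that irreflpD[OF irreflp_rooted_gt] transpD[OF transp_rooted_gt]
      by (metis linorder_neqE_nat)
  qed
  have "distinct ?Ys"
    unfolding distinct_conv_nth using lt irreflpD[OF irreflp_rooted_gt] by (metis linorder_neqE_nat)
  \<comment> \<open>Positions start at 0: \<open>?Ys ! (r - 1)\<close> is the \<open>r\<close>-th
    generator, and \<open>take (r - 1)\<close> collects those before it.\<close>
  moreover have "\<exists>V\<subseteq>{1..n}. ideal_colon n (Idl\<^bsub>poly_ring n\<^esub> (set (take (r - 1) ?Ys)))
      (Idl\<^bsub>poly_ring n\<^esub> {?Ys ! (r - 1)}) = Idl\<^bsub>poly_ring n\<^esub> (X ` V)" if r: "r \<in> {2..length ?Ys}" for r
  proof -
    have r': "r - 1 < length ?Ys" using r by auto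
    obtain a where a: "?Ys ! (r - 1) = monomial a" "min_cover n s a"
      using nth_mem[OF r'] unfolding set by blast
    let ?B = "{b. min_cover n s b \<and> greedy_gt n s b a}"
    have gt: "?P (monomial b) (monomial a) \<longleftrightarrow> greedy_gt n s b a" if "min_cover n s b" for b
      using rooted_gt_iff_greedy_gt[OF that a(2) assms(1)] .
    \<comment> \<open>In a strictly sorted list the entries before a position are exactly those that
      precede its entry in the order, so this ideal is generated by the \<open>b\<close> with
      \<open>greedy_gt n s b a\<close>.\<close>
    have take: "set (take (r - 1) ?Ys) = {y \<in> set ?Ys. ?P y (monomial a)}"
    proof -
      have "y \<in> set (take (r - 1) ?Ys) \<longleftrightarrow> y \<in> set ?Ys \<and> ?P y (monomial a)" for y
      proof -
        have "y \<in> set (take (r - 1) ?Ys) \<longleftrightarrow> (\<exists>i<r - 1. y = ?Ys ! i)"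
          using r' by (auto simp: in_set_conv_nth)
        also have "\<dots> \<longleftrightarrow> (\<exists>i<length ?Ys. y = ?Ys ! i \<and> ?P (?Ys ! i) (?Ys ! (r - 1)))"
          using lt[OF _ r'] less_trans[OF _ r'] by blast
        also have "\<dots> \<longleftrightarrow> y \<in> set ?Ys \<and> ?P y (monomial a)"
          unfolding a(1) by (auto simp: in_set_conv_nth)
        finally show ?thesis .
      qed
      thus ?thesis by blast
    qed
    have B: "set (take (r - 1) ?Ys) = monomial ` ?B"
      unfolding take set using gt by auto
    show ?thesis unfolding B a(1)
    proof (rule ideal_colon_variables)
      show "\<forall>b\<in>?B. keys b \<subseteq> {1..n}" using is_cover_keys min_cover_imp by blast
      show "keys a \<subseteq> {1..n}" using is_cover_keys min_cover_imp a(2) by blast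
      fix b assume "b \<in> ?B"
      hence b: "greedy_gt n s b a" "min_cover n s b" by auto
      obtain j c where "1 \<le> j" "j \<le> n" "lookup a j < lookup b j" "min_cover n s c" "c \<preceq> a + var j"
          "greedy_gt n s c a"
        using greedy_exchange_min[OF b a(2)] .
      thus "\<exists>j\<in>{1..n}. lookup a j < lookup b j \<and> (\<exists>c\<in>?B. c \<preceq> a + var j)"
        by (intro bexI[of _ j]) auto
    qed
  qed
  ultimately show ?thesis
    using set by (simp add: has_linear_quotients_def min_mon_gens_path_cover_power)
qed

end
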